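(* Let $\Omega$ be a $D$-set, possibly augmented with unary predicates. Let $s=(a_i)_{i\in I}$ be an unbounded indiscernible sequence of single elements of $\Omega$, and let $B\subseteq\Omega$. Then $s$ is weakly indiscernible over $B$ if and only if $B\cap H(s)=\emptyset$.
   Context: A $D$-set is a set $\Omega$ with a quaternary relation $D$, written $D(wx;yz)$ or $wx|yz$, satisfying for all $w,x,y,z$: (D1) $D(wx;yz)\to (D(xw;yz)\wedge D(yz;wx))$; (D2) $D(wx;yz)\to\neg D(wy;xz)$; (D3) $D(wx;yz)\to\forall v\,(D(vx;yz)\vee D(wx;yv))$; (D4) $(w\neq y\wedge x\neq y)\to D(wx;yy)$. A splitting of $\Omega$ is a partition into at least two parts (sectors) such that (i) if $a,b$ lie in a part $\Sigma$ and $c,d\notin\Sigma$ then $D(ab;cd)$, (ii) if $a,b,c,d$ lie in four distinct parts then $\neg D(ab;cd)$; a node splitting has more than two sectors. Every splitting of a subset $A$ (with induced relation) with more than two parts extends uniquely to a node splitting of $\Omega$ whose sectors meet $A$ in the parts. A sequence is indexed by a linear order $I$; it is unbounded if $I$ has no least and no greatest element; indiscernible means order-indiscernible over $\emptyset$ in the full language. An indiscernible sequence $s=(a_i)$ of single elements is constant, or petaled (elements pairwise distinct and no $D(a_ia_j;a_ka_\ell)$ holds with $i,j,k,\ell$ pairwise distinct), or monotonic (elements pairwise distinct and $a_ia_j|a_ka_\ell$ for all $i<j<k<\ell$). The discernible hull $H(s)$ is: $\emptyset$ if $s$ is constant; if $s$ is petaled, the union of the sectors containing elements of $s$ of the node splitting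 of $\Omega$ extending $\{\{a_i\}:i\in I\}$; if $s$ is monotonic, the union of $s$ with $H_1(s)=\{x:\exists i<j<k,\ a_ia_k|a_jx\}$, $H_2(s)=\{x:\exists i<j<k$ such that no $D$-relation holds on $\{a_i,a_j,a_k,x\}\}$ (no $D(pq;rt)$ with $p,q,r,t$ pairwise distinct elements of this set), and $H_3(s)=\{x:\exists i<j<k<\ell,\ a_ix|a_ka_\ell\text{ and }a_ia_j|xa_\ell\}$. $s$ is weakly indiscernible over $B$ if for every atomic formula $D(t_1t_2;t_3t_4)$ whose terms are variables or parameters from $B$, its truth value on elements of $s$ depends only on the order type of the indices used. *)

theory Defs
  imports Main "HOL-Library.Disjoint_Sets" "HOL-Library.FuncSet"
begin

text \<open>\<open>D w x y z\<close> is \<open>D(wx;yz)\<close>. The relation is only looked at on the carrier \<open>\<Omega>\<close>.\<close>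

locale D_set =
  fixes \<Omega> :: "'a set" and D :: "'a \<Rightarrow> 'a \<Rightarrow> 'a \<Rightarrow> 'a \<Rightarrow> bool"
  assumes D1: "\<lbrakk>w \<in> \<Omega>; x \<in> \<Omega>; y \<in> \<Omega>; z \<in> \<Omega>; D w x y z\<rbrakk> \<Longrightarrow> D x w y z \<and> D y z w x"
    and D2: "\<lbrakk>w \<in> \<Omega>; x \<in> \<Omega>; y \<in> \<Omega>; z \<in> \<Omega>; D w x y z\<rbrakk> \<Longrightarrow> \<not> D w y x z"
    and D3: "\<lbrakk>w \<in> \<Omega>; x \<in> \<Omega>; y \<in> \<Omega>; z \<in> \<Omega>; D w x y z; v \<in> \<Omega>\<rbrakk> \<Longrightarrow> D v x y z \<or> D w x y v"
    and D4: "\<lbrakk>w \<in> \<Omega>; x \<in> \<Omega>; y \<in> \<Omega>; w \<noteq> y; x \<noteq> y\<rbrakk> \<Longrightarrow> D w x y y"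

definition splitting :: "'a set \<Rightarrow> ('a \<Rightarrow> 'a \<Rightarrow> 'a \<Rightarrow> 'a \<Rightarrow> bool) \<Rightarrow> 'a set set \<Rightarrow> bool" where
  "splitting A D P \<longleftrightarrow>
     partition_on A P \<and> (infinite P \<or> card P \<ge> 2) \<and>
     (\<forall>S\<in>P. \<forall>a\<in>S. \<forall>b\<in>S. \<forall>c\<in>A - S. \<forall>d\<in>A - S. D a b c d) \<and>
     (\<forall>S1\<in>P. \<forall>S2\<in>P. \<forall>S3\<in>P. \<forall>S4\<in>P. distinct [S1, S2, S3, S4] \<longrightarrow>
        (\<forall>a\<in>S1. \<forall>b\<in>S2. \<forall>c\<in>S3. \<forall>d\<in>S4. \<not> D a b c d))"

definition node_splitting :: "'a set \<Rightarrow> ('a \<Rightarrow> 'a \<Rightarrow> 'a \<Rightarrow> 'a \<Rightarrow> bool) \<Rightarrow> 'a set set \<Rightarrow> bool" where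
  "node_splitting A D P \<longleftrightarrow> splitting A D P \<and> (infinite P \<or> card P > 2)"

text \<open>\<open>P\<close> may have further sectors that do not meet \<open>A\<close>.\<close>

definition extends_parts :: "'a set set \<Rightarrow> 'a set \<Rightarrow> 'a set set \<Rightarrow> bool" where
  "extends_parts P A Q \<longleftrightarrow> {S \<inter> A | S. S \<in> P} - {{}} = Q"

definition node_extension ::
    "'a set \<Rightarrow> ('a \<Rightarrow> 'a \<Rightarrow> 'a \<Rightarrow> 'a \<Rightarrow> bool) \<Rightarrow> 'a set \<Rightarrow> 'a set set \<Rightarrow> 'a set set" where
  "node_extension \<Omega> D A Q = (THE P. node_splitting \<Omega> D P \<and> extends_parts P A Q)"

datatype (preds: 'p) fm =
    Eq nat nat
  | DRel nat nat nat nat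
  | Pred 'p nat
  | Neg "'p fm"
  | Conj "'p fm" "'p fm"
  | Exists nat "'p fm"

primrec fv :: "'p fm \<Rightarrow> nat set" where
  "fv (Eq m n) = {m, n}"
| "fv (DRel k l m n) = {k, l, m, n}"
| "fv (Pred p m) = {m}"
| "fv (Neg \<phi>) = fv \<phi>"
| "fv (Conj \<phi> \<psi>) = fv \<phi> \<union> fv \<psi>"
| "fv (Exists m \<phi>) = fv \<phi> - {m}"

primrec sat :: "'a set \<Rightarrow> ('a \<Rightarrow> 'a \<Rightarrow> 'a \<Rightarrow> 'a \<Rightarrow> bool) \<Rightarrow> ('p \<Rightarrow> 'a \<Rightarrow> bool) \<Rightarrow>
    (nat \<Rightarrow> 'a) \<Rightarrow> 'p fm \<Rightarrow> bool" where
  "sat \<Omega> D U e (Eq m n) \<longleftrightarrow> e m = e n"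
| "sat \<Omega> D U e (DRel k l m n) \<longleftrightarrow> D (e k) (e l) (e m) (e n)"
| "sat \<Omega> D U e (Pred p m) \<longleftrightarrow> U p (e m)"
| "sat \<Omega> D U e (Neg \<phi>) \<longleftrightarrow> \<not> sat \<Omega> D U e \<phi>"
| "sat \<Omega> D U e (Conj \<phi> \<psi>) \<longleftrightarrow> sat \<Omega> D U e \<phi> \<and> sat \<Omega> D U e \<psi>"
| "sat \<Omega> D U e (Exists m \<phi>) \<longleftrightarrow> (\<exists>x\<in>\<Omega>. sat \<Omega> D U (e(m := x)) \<phi>)"

definition unbounded_order :: "'i::linorder set \<Rightarrow> bool" where
  "unbounded_order I \<longleftrightarrow> \<not> (\<exists>m\<in>I. \<forall>i\<in>I. m \<le> i) \<and> \<not> (\<exists>m\<in>I. \<forall>i\<in>I. i \<le> m)"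

text \<open>\<open>L\<close> is the (possibly empty) set of unary predicate symbols of the language.\<close>

definition indiscernible ::
    "'a set \<Rightarrow> ('a \<Rightarrow> 'a \<Rightarrow> 'a \<Rightarrow> 'a \<Rightarrow> bool) \<Rightarrow> 'p set \<Rightarrow> ('p \<Rightarrow> 'a \<Rightarrow> bool) \<Rightarrow>
     'i::linorder set \<Rightarrow> ('i \<Rightarrow> 'a) \<Rightarrow> bool" where
  "indiscernible \<Omega> D L U I s \<longleftrightarrow>
     (\<forall>(\<phi> :: 'p fm) n i j. preds \<phi> \<subseteq> L \<and> fv \<phi> \<subseteq> {..<n} \<and>
        i \<in> {..<n} \<rightarrow> I \<and> strict_mono_on {..<n} i \<and>
        j \<in> {..<n} \<rightarrow> I \<and> strict_mono_on {..<n} j \<longrightarrow>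
        (sat \<Omega> D U (s \<circ> i) \<phi> \<longleftrightarrow> sat \<Omega> D U (s \<circ> j) \<phi>))"

definition constant_seq :: "'i set \<Rightarrow> ('i \<Rightarrow> 'a) \<Rightarrow> bool" where
  "constant_seq I s \<longleftrightarrow> (\<forall>i\<in>I. \<forall>j\<in>I. s i = s j)"

definition petaled_seq :: "('a \<Rightarrow> 'a \<Rightarrow> 'a \<Rightarrow> 'a \<Rightarrow> bool) \<Rightarrow> 'i set \<Rightarrow> ('i \<Rightarrow> 'a) \<Rightarrow> bool" where
  "petaled_seq D I s \<longleftrightarrow> inj_on s I \<and>
     (\<forall>i\<in>I. \<forall>j\<in>I. \<forall>k\<in>I. \<forall>l\<in>I. distinct [i, j, k, l] \<longrightarrow> \<not> D (s i) (s j) (s k) (s l))"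

definition monotonic_seq ::
    "('a \<Rightarrow> 'a \<Rightarrow> 'a \<Rightarrow> 'a \<Rightarrow> bool) \<Rightarrow> 'i::linorder set \<Rightarrow> ('i \<Rightarrow> 'a) \<Rightarrow> bool" where
  "monotonic_seq D I s \<longleftrightarrow> inj_on s I \<and>
     (\<forall>i\<in>I. \<forall>j\<in>I. \<forall>k\<in>I. \<forall>l\<in>I. i < j \<and> j < k \<and> k < l \<longrightarrow> D (s i) (s j) (s k) (s l))"

definition no_D_relation_on :: "('a \<Rightarrow> 'a \<Rightarrow> 'a \<Rightarrow> 'a \<Rightarrow> bool) \<Rightarrow> 'a set \<Rightarrow> bool" where
  "no_D_relation_on D X \<longleftrightarrow>
     (\<forall>p\<in>X. \<forall>q\<in>X. \<forall>r\<in>X. \<forall>t\<in>X. distinct [p, q, r, t] \<longrightarrow> \<not> D p q r t)"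

definition H1 :: "'a set \<Rightarrow> ('a \<Rightarrow> 'a \<Rightarrow> 'a \<Rightarrow> 'a \<Rightarrow> bool) \<Rightarrow> 'i::linorder set \<Rightarrow> ('i \<Rightarrow> 'a) \<Rightarrow> 'a set" where
  "H1 \<Omega> D I s = {x\<in>\<Omega>. \<exists>i\<in>I. \<exists>j\<in>I. \<exists>k\<in>I. i < j \<and> j < k \<and> D (s i) (s k) (s j) x}"

definition H2 :: "'a set \<Rightarrow> ('a \<Rightarrow> 'a \<Rightarrow> 'a \<Rightarrow> 'a \<Rightarrow> bool) \<Rightarrow> 'i::linorder set \<Rightarrow> ('i \<Rightarrow> 'a) \<Rightarrow> 'a set" where
  "H2 \<Omega> D I s = {x\<in>\<Omega>. \<exists>i\<in>I. \<exists>j\<in>I. \<exists>k\<in>I. i < j \<and> j < k \<and>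
     no_D_relation_on D {s i, s j, s k, x}}"

definition H3 :: "'a set \<Rightarrow> ('a \<Rightarrow> 'a \<Rightarrow> 'a \<Rightarrow> 'a \<Rightarrow> bool) \<Rightarrow> 'i::linorder set \<Rightarrow> ('i \<Rightarrow> 'a) \<Rightarrow> 'a set" where
  "H3 \<Omega> D I s = {x\<in>\<Omega>. \<exists>i\<in>I. \<exists>j\<in>I. \<exists>k\<in>I. \<exists>l\<in>I. i < j \<and> j < k \<and> k < l \<and>
     D (s i) x (s k) (s l) \<and> D (s i) (s j) x (s l)}"

text \<open>For an unbounded indiscernible sequence the last branch does not occur, and the first three
  exclude one another (except for the empty sequence, which counts as constant).\<close>

definition discernible_hull ::
    "'a set \<Rightarrow> ('a \<Rightarrow> 'a \<Rightarrow> 'a \<Rightarrow> 'a \<Rightarrow> bool) \<Rightarrow> 'i::linorder set \<Rightarrow> ('i \<Rightarrow> 'a) \<Rightarrow> 'a set" where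
  "discernible_hull \<Omega> D I s =
     (if constant_seq I s then {}
      else if petaled_seq D I s then
        \<Union>{S \<in> node_extension \<Omega> D (s ` I) {{s i} | i. i \<in> I}. \<exists>i\<in>I. s i \<in> S}
      else if monotonic_seq D I s then
        s ` I \<union> H1 \<Omega> D I s \<union> H2 \<Omega> D I s \<union> H3 \<Omega> D I s
      else undefined)"

datatype (params: 'a) dterm = Var nat | Param 'a

primrec tvars :: "'a dterm \<Rightarrow> nat set" where
  "tvars (Var m) = {m}"
| "tvars (Param b) = {}"

primrec tval :: "(nat \<Rightarrow> 'a) \<Rightarrow> 'a dterm \<Rightarrow> 'a" where
  "tval e (Var m) = e m"
| "tval e (Param b) = b"

text \<open>Since \<open>I\<close> is linearly ordered, agreement of \<open><\<close> on all pairs of variables also gives agreement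
  of \<open>=\<close>, so \<open>u\<close> and \<open>v\<close> below range over the pairs of index assignments of the same order type.\<close>

definition weakly_indiscernible_over ::
    "('a \<Rightarrow> 'a \<Rightarrow> 'a \<Rightarrow> 'a \<Rightarrow> bool) \<Rightarrow> 'i::linorder set \<Rightarrow> ('i \<Rightarrow> 'a) \<Rightarrow> 'a set \<Rightarrow> bool" where
  "weakly_indiscernible_over D I s B \<longleftrightarrow>
     (\<forall>t1 t2 t3 t4 u v.
        let V = tvars t1 \<union> tvars t2 \<union> tvars t3 \<union> tvars t4 in
        params t1 \<union> params t2 \<union> params t3 \<union> params t4 \<subseteq> B \<and>
        u \<in> V \<rightarrow> I \<and> v \<in> V \<rightarrow> I \<and>
        (\<forall>m\<in>V. \<forall>n\<in>V. u m < u n \<longleftrightarrow> v m < v n) \<longrightarrow>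
        (D (tval (s \<circ> u) t1) (tval (s \<circ> u) t2) (tval (s \<circ> u) t3) (tval (s \<circ> u) t4) \<longleftrightarrow>
         D (tval (s \<circ> v) t1) (tval (s \<circ> v) t2) (tval (s \<circ> v) t3) (tval (s \<circ> v) t4)))"

end

theory Submission
  imports Defs
begin

text \<open>Think of \<open>\<Omega>\<close> as the leaves of a tree, with \<open>D(wx;yz)\<close> saying that the paths \<open>wx\<close> and \<open>yz\<close> are
  disjoint. Five terms of an indiscernible sequence suffice to see that it is constant, petaled or
  monotonic.

  For a petaled sequence all petals hang at one node. A parameter in the sector of a petal singles
  that petal out; parameters in other sectors see all petals alike, because a \<open>D\<close>-relation between
  four points that do not lie in one sector is decided by their distribution over the sectors, or
  (three points in one sector) insensitive to moving the fourth point among the other sectors.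

  A monotonic sequence is a caterpillar without ends. A parameter attached to it at a definite place
  is distinguished by a triple of terms, and these are the points of the hull. Every other
  parameter lies beyond the left or beyond the right end, so four points are separated by their order
  along the caterpillar unless three of them are parameters beyond the same end; then the fourth may be
  moved along the sequence freely.\<close>

section \<open>Calculus of the relation restricted to the carrier\<close>

context D_set
begin

text \<open>Restricting \<open>D\<close> to the carrier frees the axioms from most membership premises.\<close>

definition Q :: "'a \<Rightarrow> 'a \<Rightarrow> 'a \<Rightarrow> 'a \<Rightarrow> bool" where
  "Q w x y z \<longleftrightarrow> w \<in> \<Omega> \<and> x \<in> \<Omega> \<and> y \<in> \<Omega> \<and> z \<in> \<Omega> \<and> D w x y z"

lemma Q_mem: "Q w x y z \<Longrightarrow> w \<in> \<Omega> \<and> x \<in> \<Omega> \<and> y \<in> \<Omega> \<and> z \<in> \<Omega>"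
  by (simp add: Q_def)

lemma Q_swap: "Q w x y z \<longleftrightarrow> Q x w y z"
  using D1 unfolding Q_def by blast

lemma Q_flip: "Q w x y z \<longleftrightarrow> Q y z w x"
  using D1 unfolding Q_def by blast

lemma Q_swap': "Q w x y z \<longleftrightarrow> Q w x z y"
  by (metis Q_flip Q_swap)

lemma Q_excl: "Q w x y z \<Longrightarrow> \<not> Q w y x z"
  using D2 unfolding Q_def by blast

lemma Q_excl': "Q w x y z \<Longrightarrow> \<not> Q w z x y"
  by (metis Q_excl Q_swap')

lemma Q_subst: "Q w x y z \<Longrightarrow> v \<in> \<Omega> \<Longrightarrow> Q v x y z \<or> Q w x y v"
  using D3 unfolding Q_def by blast

text \<open>A point occurring on both sides could be moved to the two middle places, where the
  exchange in \<open>Q_excl\<close> returns the same relation.\<close>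

lemma Q_disjoint: "Q w x y z \<Longrightarrow> w \<noteq> y \<and> w \<noteq> z \<and> x \<noteq> y \<and> x \<noteq> z"
  by (metis Q_excl Q_swap Q_swap')

text \<open>The converse is D4 after a flip. Relations with a repeated point on one side thus depend
  on membership and equalities alone.\<close>

lemma Q_same: "Q w w y z \<longleftrightarrow> w \<in> \<Omega> \<and> y \<in> \<Omega> \<and> z \<in> \<Omega> \<and> w \<noteq> y \<and> w \<noteq> z"
proof
  show "Q w w y z \<Longrightarrow> w \<in> \<Omega> \<and> y \<in> \<Omega> \<and> z \<in> \<Omega> \<and> w \<noteq> y \<and> w \<noteq> z"
    using Q_disjoint Q_mem by blast
  show "w \<in> \<Omega> \<and> y \<in> \<Omega> \<and> z \<in> \<Omega> \<and> w \<noteq> y \<and> w \<noteq> z \<Longrightarrow> Q w w y z"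
    by (metis D4 Q_def Q_flip)
qed

lemma Q_same': "Q w x y y \<longleftrightarrow> w \<in> \<Omega> \<and> x \<in> \<Omega> \<and> y \<in> \<Omega> \<and> y \<noteq> w \<and> y \<noteq> x"
  using Q_flip Q_same by blast

text \<open>Substituting \<open>z\<close> into the first relation and \<open>x\<close> into the
  second either gives the claim or two incompatible pairings of \<open>x\<close>, \<open>y\<close>,
  \<open>k\<close>, \<open>z\<close>.\<close>

lemma Q_trans:
  assumes "Q x y k l" "Q y z k l"
  shows "Q x z k l"
proof -
  have m: "x \<in> \<Omega>" "z \<in> \<Omega>" using assms Q_mem by blast+
  have "Q z x k l \<or> Q y x k z"
    using Q_subst[of y x k l z] m assms Q_swap by blast
  moreover have "Q x k z y \<or> Q l k z x"
    using Q_subst[of l k z y x] m assms Q_swap Q_flip by blast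
  ultimately show ?thesis
    by (metis Q_excl Q_flip Q_swap)
qed

lemma Q_trans': "Q k l x y \<Longrightarrow> Q k l y z \<Longrightarrow> Q k l x z"
  using Q_trans Q_flip by blast

end

section \<open>Unbounded index sets and instances of indiscernibility\<close>

lemma unbounded_above:
  assumes "unbounded_order I" "finite F" "F \<subseteq> I" "I \<noteq> {}"
  obtains m where "m \<in> I" "\<forall>f\<in>F. f < m"
proof (cases "F = {}")
  case True then show ?thesis using assms(4) that by auto
next
  case False
  then have "Max F \<in> I" using assms Max_in by blast
  then obtain m where "m \<in> I" "Max F < m"
    using assms(1) unfolding unbounded_order_def by (meson not_le)
  then show ?thesis using that assms(2) False by auto
qed

lemma unbounded_below:
  assumes "unbounded_order I" "i \<in> I"
  obtains m where "m \<in> I" "m < i"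
  using assms unfolding unbounded_order_def by (meson not_le)

text \<open>Sorted lists play the role of increasing maps on initial segments, so that concrete
  index tuples can be written out.\<close>

lemma indiscernibleD:
  assumes "indiscernible \<Omega> D L U I s" "preds \<phi> \<subseteq> L" "fv \<phi> \<subseteq> {..<length is}"
    "set is \<subseteq> I" "sorted_wrt (<) is" "set js \<subseteq> I" "sorted_wrt (<) js" "length js = length is"
  shows "sat \<Omega> D U (\<lambda>n. s (is ! n)) \<phi> \<longleftrightarrow> sat \<Omega> D U (\<lambda>n. s (js ! n)) \<phi>"
proof -
  have "(!) xs \<in> {..<length xs} \<rightarrow> I \<and> strict_mono_on {..<length xs} ((!) xs)"
    if "set xs \<subseteq> I" "sorted_wrt (<) xs" for xs
    using that by (auto simp: strict_mono_on_def sorted_wrt_iff_nth_less)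
  from this[of "is"] this[of js] show ?thesis
    using assms unfolding indiscernible_def comp_def by metis
qed

lemma weakly_indiscernible_param_3:
  assumes "weakly_indiscernible_over D I s B" "b \<in> B"
    "i \<in> I" "j \<in> I" "k \<in> I" "i' \<in> I" "j' \<in> I" "k' \<in> I"
    "i < j \<longleftrightarrow> i' < j'" "j < i \<longleftrightarrow> j' < i'" "i < k \<longleftrightarrow> i' < k'"
    "k < i \<longleftrightarrow> k' < i'" "j < k \<longleftrightarrow> j' < k'" "k < j \<longleftrightarrow> k' < j'"
  shows "D b (s i) (s j) (s k) \<longleftrightarrow> D b (s i') (s j') (s k')"
  using assms(1)[unfolded weakly_indiscernible_over_def, rule_format,
      of "Param b" "Var 0" "Var 1" "Var 2" "(!) [i, j, k]" "(!) [i', j', k']"] assms(2-)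
  by (auto simp: Let_def)

text \<open>On the carrier this instance expresses that \<open>b\<close> differs from a term, so it
  detects parameters lying on the sequence.\<close>

lemma weakly_indiscernible_param_2:
  assumes "weakly_indiscernible_over D I s B" "b \<in> B" "i \<in> I" "j \<in> I"
  shows "D b b (s i) (s i) \<longleftrightarrow> D b b (s j) (s j)"
  using assms(1)[unfolded weakly_indiscernible_over_def, rule_format,
      of "Param b" "Param b" "Var 0" "Var 0" "\<lambda>_. i" "\<lambda>_. j"] assms(2-)
  by (auto simp: Let_def)

section \<open>Injective indiscernible sequences are petaled or monotonic\<close>

locale D_seq = D_set \<Omega> D for \<Omega> :: "'a set" and D +
  fixes I :: "'i::linorder set" and s :: "'i \<Rightarrow> 'a"
  assumes unb: "unbounded_order I"
    and ne: "I \<noteq> {}"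
    and s_mem: "i \<in> I \<Longrightarrow> s i \<in> \<Omega>"
    and s_inj: "i \<in> I \<Longrightarrow> j \<in> I \<Longrightarrow> s i = s j \<longleftrightarrow> i = j"
begin

lemma above:
  assumes "finite F" "F \<subseteq> I"
  obtains m where "m \<in> I" "\<forall>f\<in>F. f < m"
  using unbounded_above[OF unb assms ne] by blast

lemma chain_above:
  assumes "finite F" "F \<subseteq> I"
  shows "\<exists>a\<in>I. \<exists>b\<in>I. \<exists>c\<in>I. \<exists>d\<in>I. \<exists>e\<in>I.
    (\<forall>f\<in>F. f < a) \<and> a < b \<and> b < c \<and> c < d \<and> d < e"
proof -
  obtain a where a: "a \<in> I" "\<forall>f\<in>F. f < a" using above assms .
  obtain b where b: "b \<in> I" "a < b" using above[of "{a}"] a by auto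
  obtain c where c: "c \<in> I" "b < c" using above[of "{b}"] b by auto
  obtain d where d: "d \<in> I" "c < d" using above[of "{c}"] c by auto
  obtain e where e: "e \<in> I" "d < e" using above[of "{d}"] d by auto
  show ?thesis using a b c d e by blast
qed

text \<open>Each of the three pairings of an increasing quadruple holds for all such quadruples or
  for none. A fifth term rules out the pairings ac|bd and ad|bc; whether ab|cd holds separates the
  two cases.\<close>

lemma petaled_or_monotonic:
  assumes ind: "indiscernible \<Omega> D L U I s"
  shows "petaled_seq D I s \<or> monotonic_seq D I s"
proof -
  have tr: "D (s ([i,j,k,l] ! p)) (s ([i,j,k,l] ! q)) (s ([i,j,k,l] ! r)) (s ([i,j,k,l] ! t)) \<longleftrightarrow>
     D (s ([i',j',k',l'] ! p)) (s ([i',j',k',l'] ! q)) (s ([i',j',k',l'] ! r)) (s ([i',j',k',l'] ! t))"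
    if "i < j" "j < k" "k < l" "i' < j'" "j' < k'" "k' < l'"
      "{i,j,k,l,i',j',k',l'} \<subseteq> I" "p < 4" "q < 4" "r < 4" "t < 4"
    for i j k l i' j' k' l' p q r t
    using indiscernibleD[OF ind, of "DRel p q r t" "[i,j,k,l]" "[i',j',k',l']"] that by fastforce
  have t1: "Q (s i) (s j) (s k) (s l) \<longleftrightarrow> Q (s i') (s j') (s k') (s l')"
    and t2: "Q (s i) (s k) (s j) (s l) \<longleftrightarrow> Q (s i') (s k') (s j') (s l')"
    and t3: "Q (s i) (s l) (s j) (s k) \<longleftrightarrow> Q (s i') (s l') (s j') (s k')"
    if "i < j" "j < k" "k < l" "i' < j'" "j' < k'" "k' < l'"
      "{i,j,k,l,i',j',k',l'} \<subseteq> I" for i j k l i' j' k' l'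
    using tr[OF that, of 0 1 2 3] tr[OF that, of 0 2 1 3] tr[OF that, of 0 3 1 2] that(7) s_mem
    by (auto simp: Q_def)
  obtain a b c d e where ch: "a < b" "b < c" "c < d" "d < e"
    "a \<in> I" "b \<in> I" "c \<in> I" "d \<in> I" "e \<in> I" using chain_above[of "{}"] by auto
  have mem: "s a \<in> \<Omega>" "s b \<in> \<Omega>" "s c \<in> \<Omega>" "s d \<in> \<Omega>" "s e \<in> \<Omega>" using ch s_mem by auto
  have ord: "a < c" "a < d" "b < d" "b < e" "c < e" using ch by auto
  \<comment> \<open>If ac|bd held, it would hold for every increasing quadruple. Substituting
    \<open>s e\<close> gives ae|bd or ac|de, which clash with ad|be and ad|ce.\<close>
  have n2: "\<not> Q (s a) (s c) (s b) (s d)"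
  proof
    assume q: "Q (s a) (s c) (s b) (s d)"
    have "Q (s a) (s d) (s b) (s e)" "Q (s a) (s d) (s c) (s e)"
      using q t2[of a b c d a b d e] t2[of a b c d a c d e] ch ord by auto
    moreover have "Q (s e) (s a) (s b) (s d) \<or> Q (s c) (s a) (s e) (s d)"
      using Q_subst[of "s c" "s a" "s d" "s b" "s e"] q mem Q_swap Q_swap' by blast
    ultimately show False by (metis Q_excl Q_swap Q_flip)
  qed
  \<comment> \<open>Likewise ad|bc leads to de|bc or ad|ce, against be|cd and ae|cd.\<close>
  have n3: "\<not> Q (s a) (s d) (s b) (s c)"
  proof
    assume q: "Q (s a) (s d) (s b) (s c)"
    have "Q (s b) (s e) (s c) (s d)" "Q (s a) (s e) (s c) (s d)"
      using q t3[of a b c d b c d e] t3[of a b c d a c d e] ch ord by auto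
    moreover have "Q (s e) (s d) (s b) (s c) \<or> Q (s a) (s d) (s e) (s c)"
      using Q_subst[of "s a" "s d" "s c" "s b" "s e"] q mem Q_swap Q_swap' by blast
    ultimately show False by (metis Q_excl Q_swap Q_flip)
  qed
  show ?thesis
  proof (cases "Q (s a) (s b) (s c) (s d)")
    case True
    then have "Q (s i) (s j) (s k) (s l)" if "i < j" "j < k" "k < l" "{i,j,k,l} \<subseteq> I" for i j k l
      using t1[of a b c d i j k l] ch that by auto
    then show ?thesis unfolding monotonic_seq_def Q_def
      using s_inj by (auto intro!: inj_onI)
  next
    case False
    then have no: "\<not> Q (s i) (s j) (s k) (s l)" "\<not> Q (s i) (s k) (s j) (s l)" "\<not> Q (s i) (s l) (s j) (s k)"
      if "i < j" "j < k" "k < l" "{i,j,k,l} \<subseteq> I" for i j k l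
      using n2 n3 t1[of a b c d i j k l] t2[of a b c d i j k l] t3[of a b c d i j k l] ch that by auto
    have "\<not> Q (s i) (s j) (s k) (s l)" if d: "distinct [i,j,k,l]" and m: "{i,j,k,l} \<subseteq> I" for i j k l
    proof -
      \<comment> \<open>By the symmetries of the relation both pairs may be taken increasing, with
        the smaller first index in front. Three interleavings remain, one for each clause of
        \<open>no\<close>.\<close>
      have *: "\<not> Q (s i) (s j) (s k) (s l)" if o: "i < j" "k < l" "i < k" "distinct [i,j,k,l]" "{i,j,k,l} \<subseteq> I" for i j k l
      proof -
        consider "j < k" | "k < j" "j < l" | "l < j" using o by force
        then show ?thesis
        proof cases
          case 1 then show ?thesis using no(1)[of i j k l] o by auto
        next
          case 2 then show ?thesis using no(2)[of i k j l] o by auto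
        next
          case 3 then show ?thesis using no(3)[of i k l j] o by auto
        qed
      qed
      have **: "\<not> Q (s i) (s j) (s k) (s l)" if "i < j" "k < l" "distinct [i,j,k,l]" "{i,j,k,l} \<subseteq> I" for i j k l
      proof (cases "i < k")
        case True then show ?thesis using * that by blast
      next
        case False
        then have "k < i" using that by force
        then show ?thesis using *[of k l i j] that Q_flip by auto
      qed
      have ***: "\<not> Q (s i) (s j) (s k) (s l)" if "i < j" "distinct [i,j,k,l]" "{i,j,k,l} \<subseteq> I" for i j k l
        using **[of i j k l] **[of i j l k] that Q_swap' by (cases k l rule: linorder_cases) auto
      show ?thesis
        using ***[of i j k l] ***[of j i k l] d m Q_swap by (cases i j rule: linorder_cases) auto
    qed
    then have "petaled_seq D I s" unfolding petaled_seq_def Q_def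
      using s_inj s_mem by (auto intro!: inj_onI)
    then show ?thesis ..
  qed
qed

end

section \<open>Reduction of weak indiscernibility to four distinct points\<close>

context D_seq
begin

text \<open>The trace left on points by two index assignments of the same order type: a pair
  consists of the values of one term under both. Later arguments need not mention terms and
  variables.\<close>

definition similar :: "'a set \<Rightarrow> ('a \<times> 'a) set \<Rightarrow> bool" where
  "similar B F \<longleftrightarrow>
     (\<forall>(x, y)\<in>F. x \<in> B \<and> y = x \<or> (\<exists>i\<in>I. \<exists>j\<in>I. x = s i \<and> y = s j)) \<and>
     (\<forall>i\<in>I. \<forall>j\<in>I. \<forall>i'\<in>I. \<forall>j'\<in>I. (s i, s j) \<in> F \<longrightarrow> (s i', s j') \<in> F \<longrightarrow> (i < i' \<longleftrightarrow> j < j'))"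

lemma similar_cases:
  assumes "similar B F" "(x, y) \<in> F"
  obtains "x \<in> B" "y = x" | i j where "i \<in> I" "j \<in> I" "x = s i" "y = s j"
  using assms unfolding similar_def by blast

lemma similar_less:
  assumes "similar B F" "(s i, s j) \<in> F" "(s i', s j') \<in> F" "i \<in> I" "j \<in> I" "i' \<in> I" "j' \<in> I"
  shows "i < i' \<longleftrightarrow> j < j'"
  using assms unfolding similar_def by blast

lemma similar_eq_iff:
  assumes F: "similar B F" "B \<inter> s ` I = {}" and m: "(x, y) \<in> F" "(x', y') \<in> F"
  shows "x = x' \<longleftrightarrow> y = y'"
  using F(1) m(1)
proof (cases rule: similar_cases)
  case 1
  show ?thesis using F(1) m(2) by (cases rule: similar_cases) (use 1 F(2) in auto)
next
  case (2 i j)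
  note ij = 2
  show ?thesis using F(1) m(2)
  proof (cases rule: similar_cases)
    case 1
    then show ?thesis using ij F(2) by auto
  next
    case (2 i' j')
    then have "i < i' \<longleftrightarrow> j < j'" "i' < i \<longleftrightarrow> j' < j"
      using ij similar_less[OF F(1)] m by blast+
    then have "i = i' \<longleftrightarrow> j = j'" by (metis linorder_neq_iff)
    then show ?thesis using ij 2 s_inj by simp
  qed
qed

text \<open>One implication suffices because the two assignments can be interchanged. Repeated
  points are settled by \<open>Q_same\<close> and \<open>Q_same'\<close>, since similarity preserves
  equalities when \<open>B\<close> avoids the sequence.\<close>

lemma weakly_indiscernibleI:
  assumes B: "B \<subseteq> \<Omega>" "B \<inter> s ` I = {}"
    and step: "\<And>F x1 x2 x3 x4 y1 y2 y3 y4. similar B F \<Longrightarrow>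
      {(x1, y1), (x2, y2), (x3, y3), (x4, y4)} \<subseteq> F \<Longrightarrow>
      distinct [x1, x2, x3, x4] \<Longrightarrow> distinct [y1, y2, y3, y4] \<Longrightarrow>
      {y1, y2, y3, y4} \<subseteq> \<Omega> \<Longrightarrow> Q x1 x2 x3 x4 \<Longrightarrow> Q y1 y2 y3 y4"
  shows "weakly_indiscernible_over D I s B"
proof -
  have imp: "D (tval (s \<circ> v) t1) (tval (s \<circ> v) t2) (tval (s \<circ> v) t3) (tval (s \<circ> v) t4)"
    if V: "V = tvars t1 \<union> tvars t2 \<union> tvars t3 \<union> tvars t4"
      and P: "params t1 \<union> params t2 \<union> params t3 \<union> params t4 \<subseteq> B"
      and uv: "u \<in> V \<rightarrow> I" "v \<in> V \<rightarrow> I" and less: "\<forall>m\<in>V. \<forall>n\<in>V. u m < u n \<longleftrightarrow> v m < v n"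
      and D: "D (tval (s \<circ> u) t1) (tval (s \<circ> u) t2) (tval (s \<circ> u) t3) (tval (s \<circ> u) t4)"
    for t1 t2 t3 t4 u v V
  proof -
    define F where "F = (\<lambda>t. (tval (s \<circ> u) t, tval (s \<circ> v) t)) ` {t1, t2, t3, t4}"
    have term_cases: "(\<exists>b\<in>B. t = Param b) \<or> (\<exists>m\<in>V. t = Var m \<and> u m \<in> I \<and> v m \<in> I)"
      if "t \<in> {t1, t2, t3, t4}" for t
      using that V P uv by (cases t) auto
    have val: "(x \<in> B \<and> y = x) \<or> (\<exists>m\<in>V. x = s (u m) \<and> y = s (v m) \<and> u m \<in> I \<and> v m \<in> I)"
      if "(x, y) \<in> F" for x y
      using that term_cases unfolding F_def by force
    have sim: "similar B F"
      unfolding similar_def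
    proof (intro conjI ballI impI)
      fix z assume "z \<in> F"
      then show "case z of (x, y) \<Rightarrow> x \<in> B \<and> y = x \<or> (\<exists>i\<in>I. \<exists>j\<in>I. x = s i \<and> y = s j)"
        using val by blast
    next
      fix i j i' j'
      assume m: "i \<in> I" "j \<in> I" "i' \<in> I" "j' \<in> I" and F: "(s i, s j) \<in> F" "(s i', s j') \<in> F"
      have "\<exists>m\<in>V. i = u m \<and> j = v m" if "(s i, s j) \<in> F" "i \<in> I" "j \<in> I" for i j
        using val[OF that(1)] that(2,3) B(2) s_inj by auto
      then show "i < i' \<longleftrightarrow> j < j'" using F m less by metis
    qed
    have inF: "(tval (s \<circ> u) t, tval (s \<circ> v) t) \<in> F" if "t \<in> {t1, t2, t3, t4}" for t
      using that unfolding F_def by blast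
    have mem: "tval (s \<circ> u) t \<in> \<Omega> \<and> tval (s \<circ> v) t \<in> \<Omega>" if "t \<in> {t1, t2, t3, t4}" for t
      using term_cases[OF that] B(1) s_mem by auto
    have eq: "tval (s \<circ> u) t = tval (s \<circ> u) t' \<longleftrightarrow> tval (s \<circ> v) t = tval (s \<circ> v) t'"
      if "t \<in> {t1, t2, t3, t4}" "t' \<in> {t1, t2, t3, t4}" for t t'
      using similar_eq_iff[OF sim B(2) inF inF] that by blast
    let ?x = "tval (s \<circ> u)" and ?y = "tval (s \<circ> v)"
    have Qx: "Q (?x t1) (?x t2) (?x t3) (?x t4)" using D mem unfolding Q_def by simp
    have ne: "?y t1 \<noteq> ?y t3" "?y t1 \<noteq> ?y t4" "?y t2 \<noteq> ?y t3" "?y t2 \<noteq> ?y t4"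
      using Q_disjoint[OF Qx] eq by auto
    have "Q (?y t1) (?y t2) (?y t3) (?y t4)"
    proof (cases "?y t1 = ?y t2 \<or> ?y t3 = ?y t4")
      case True
      then show ?thesis using ne mem Q_same Q_same' by auto
    next
      case False
      then have d: "distinct [?y t1, ?y t2, ?y t3, ?y t4]" using ne by simp
      then have dx: "distinct [?x t1, ?x t2, ?x t3, ?x t4]" using eq by simp
      have "{(?x t1, ?y t1), (?x t2, ?y t2), (?x t3, ?y t3), (?x t4, ?y t4)} \<subseteq> F" using inF by simp
      from step[OF sim this dx d _ Qx] mem show ?thesis by simp
    qed
    then show ?thesis unfolding Q_def by blast
  qed
  show ?thesis
    unfolding weakly_indiscernible_over_def Let_def
    by (intro allI impI iffI; elim conjE; erule (2) imp[OF refl]; simp)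
qed

end

section \<open>Petaled sequences: the sectors at the common node\<close>

locale petaled = D_seq +
  assumes petals: "i \<in> I \<Longrightarrow> j \<in> I \<Longrightarrow> k \<in> I \<Longrightarrow> l \<in> I \<Longrightarrow> i \<noteq> j \<Longrightarrow> k \<noteq> l \<Longrightarrow>
    \<not> Q (s i) (s j) (s k) (s l)"
begin

text \<open>Any path between two petals passes through their common node, so a path from \<open>x\<close> to \<open>y\<close> that
  avoids one stays inside a single sector at that node.\<close>

definition eqv :: "'a \<Rightarrow> 'a \<Rightarrow> bool" where
  "eqv x y \<longleftrightarrow> (\<exists>i\<in>I. \<exists>j\<in>I. i \<noteq> j \<and> Q x y (s i) (s j))"

lemma eqv_mem: "eqv x y \<Longrightarrow> x \<in> \<Omega> \<and> y \<in> \<Omega>"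
  unfolding eqv_def Q_def by blast

lemma eqv_sym: "eqv x y \<longleftrightarrow> eqv y x"
  unfolding eqv_def using Q_swap by blast

lemma infinite_index: "infinite I"
proof
  assume "finite I"
  then obtain m where "m \<in> I" "\<forall>f\<in>I. f < m" using above by auto
  then show False by auto
qed

text \<open>Substituting another petal for \<open>y\<close> would produce a relation among petals,
  so that petal must replace a witness instead. The witnesses in \<open>eqv\<close> can thus be
  exchanged for any petals other than \<open>s k\<close>.\<close>

lemma petal_Q:
  assumes "eqv y (s k)" "k \<in> I" "a \<in> I" "b \<in> I" "a \<noteq> k" "b \<noteq> k"
  shows "Q y (s k) (s a) (s b)"
proof -
  obtain i j where ij: "i \<in> I" "j \<in> I" "i \<noteq> j" "Q y (s k) (s i) (s j)"
    using assms(1) eqv_def by blast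
  have "Q y (s k) (s i) (s c)" if "c \<in> I" "c \<noteq> k" for c
    using Q_subst[OF ij(4), of "s c"] petals[of c k i j] that ij assms(2) s_mem by blast
  then show ?thesis using assms Q_trans' Q_swap' by meson
qed

text \<open>Two petals in one sector could be joined through \<open>y\<close> by transitivity, away
  from two further petals, which \<open>petals\<close> forbids.\<close>

lemma petal_unique:
  assumes "eqv y (s k)" "eqv y (s m)" "k \<in> I" "m \<in> I"
  shows "k = m"
proof (rule ccontr)
  assume ne: "k \<noteq> m"
  obtain a b where "a \<in> I" "b \<in> I" "k < a" "m < a" "a < b"
    using chain_above[of "{k,m}"] assms by auto
  then have "a \<noteq> k" "a \<noteq> m" "b \<noteq> k" "b \<noteq> m" "a \<noteq> b" and ab: "a \<in> I" "b \<in> I" by auto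
  then have "Q (s k) y (s a) (s b)" "Q y (s m) (s a) (s b)"
    using petal_Q assms Q_swap by blast+
  then show False using Q_trans petals ne assms ab \<open>a \<noteq> b\<close> by blast
qed

text \<open>The same exchange as in \<open>petal_Q\<close>: the refused alternative would put
  \<open>y\<close> in the sector of the petal substituted for \<open>x\<close>.\<close>

lemma eqv_Q:
  assumes "eqv x y" "k \<in> I" "l \<in> I" "\<not> eqv y (s k)" "\<not> eqv y (s l)"
  shows "Q x y (s k) (s l)"
proof -
  obtain i j where ij: "i \<in> I" "j \<in> I" "i \<noteq> j" "Q x y (s i) (s j)"
    using assms(1) eqv_def by blast
  have "Q x y (s i) (s c)" if "c \<in> I" "\<not> eqv y (s c)" for c
  proof -
    have "\<not> Q (s c) y (s i) (s j)" using that ij eqv_def Q_swap by blast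
    then show ?thesis using Q_subst[OF ij(4), of "s c"] that s_mem by blast
  qed
  then show ?thesis using assms Q_trans' Q_swap' by meson
qed

text \<open>There are infinitely many petals, and each point shares its sector with at most one of
  them.\<close>

lemma fresh_petal:
  assumes "finite X" "finite F"
  obtains k where "k \<in> I" "k \<notin> F" "\<forall>x\<in>X. \<not> eqv x (s k)"
proof -
  have "finite {k \<in> I. eqv x (s k)}" for x
  proof (cases "\<exists>k\<in>I. eqv x (s k)")
    case True
    then obtain k where "k \<in> I" "eqv x (s k)" by blast
    then have "{k \<in> I. eqv x (s k)} \<subseteq> {k}" using petal_unique by blast
    then show ?thesis using finite_subset by blast
  next
    case False
    then show ?thesis by (metis (no_types, lifting) empty_Collect_eq finite.emptyI)
  qed
  then have "finite (F \<union> (\<Union>x\<in>X. {k \<in> I. eqv x (s k)}))" using assms by blast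
  then obtain k where "k \<in> I" "k \<notin> F \<union> (\<Union>x\<in>X. {k \<in> I. eqv x (s k)})"
    using infinite_index by (meson finite_subset subsetI)
  then show ?thesis using that by blast
qed

lemma fresh_petals:
  assumes "finite X"
  obtains i j k where "i \<in> I" "j \<in> I" "k \<in> I" "i \<noteq> j" "i \<noteq> k" "j \<noteq> k"
    "\<And>x. x \<in> X \<Longrightarrow> \<not> eqv x (s i)" "\<And>x. x \<in> X \<Longrightarrow> \<not> eqv x (s j)" "\<And>x. x \<in> X \<Longrightarrow> \<not> eqv x (s k)"
proof -
  obtain i where i: "i \<in> I" "\<forall>x\<in>X. \<not> eqv x (s i)" using fresh_petal[of X "{}"] assms by auto
  obtain j where j: "j \<in> I" "j \<noteq> i" "\<forall>x\<in>X. \<not> eqv x (s j)"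
    using fresh_petal[of X "{i}"] assms by auto
  obtain k where k: "k \<in> I" "k \<noteq> i" "k \<noteq> j" "\<forall>x\<in>X. \<not> eqv x (s k)"
    using fresh_petal[of X "{i,j}"] assms by auto
  show thesis using that[of i j k] i j k by blast
qed

lemma eqv_refl: "x \<in> \<Omega> \<Longrightarrow> eqv x x"
proof -
  assume x: "x \<in> \<Omega>"
  obtain a b c where "a < b" "b < c" and m: "a \<in> I" "b \<in> I" "c \<in> I"
    using chain_above[of "{}"] by auto
  then have d: "a \<noteq> b" "b \<noteq> c" "a \<noteq> c" by auto
  then have "(x \<noteq> s a \<and> x \<noteq> s b) \<or> (x \<noteq> s b \<and> x \<noteq> s c) \<or> (x \<noteq> s a \<and> x \<noteq> s c)"
    using s_inj m by metis
  then show ?thesis unfolding eqv_def Q_same using m d x s_mem by blast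
qed

text \<open>Two petals outside the sector of \<open>y\<close> serve as common witnesses for both
  equivalences by \<open>eqv_Q\<close>; then \<open>Q_trans\<close> applies.\<close>

lemma eqv_trans: "eqv x y \<Longrightarrow> eqv y z \<Longrightarrow> eqv x z"
proof -
  assume xy: "eqv x y" and yz: "eqv y z"
  obtain i j where ij: "i \<in> I" "j \<in> I" "i \<noteq> j" "\<not> eqv y (s i)" "\<not> eqv y (s j)"
    using fresh_petals[of "{y}"] by (metis finite.simps singletonI)
  then have "Q x y (s i) (s j)" "Q y z (s i) (s j)"
    using eqv_Q xy yz eqv_sym Q_swap by blast+
  then show ?thesis using Q_trans ij eqv_def by blast
qed

lemma petals_not_eqv: "i \<in> I \<Longrightarrow> j \<in> I \<Longrightarrow> eqv (s i) (s j) \<longleftrightarrow> i = j"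
  using petal_unique eqv_refl s_mem by blast

text \<open>Points are replaced by fresh petals one at a time. Each use of D3 yields a relation with
  one more point replaced or puts two petals on one side; the latter forces two points of different
  sectors into one.\<close>

lemma distinct_sectors_not_Q:
  assumes "\<not> eqv a b" "\<not> eqv a c" "\<not> eqv a d" "\<not> eqv b c" "\<not> eqv b d" "\<not> eqv c d"
  shows "\<not> Q a b c d"
proof
  have two: "\<not> Q (s i) b (s j) d"
    if ij: "i \<in> I" "j \<in> I" "i \<noteq> j" and "\<not> eqv b (s i)" "\<not> eqv d (s j)" for i j b d
  proof
    assume q: "Q (s i) b (s j) d"
    obtain k where k: "k \<in> I" "k \<noteq> i" "k \<noteq> j" "\<not> eqv b (s k)" "\<not> eqv d (s k)"
      using fresh_petal[of "{b,d}" "{i,j}"] by auto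
    have "Q b (s i) (s j) d" using q Q_swap by blast
    then have "Q (s k) (s i) (s j) d \<or> Q b (s i) (s j) (s k)"
      using Q_subst k s_mem by blast
    then show False using that k unfolding eqv_def by (metis Q_flip Q_swap)
  qed
  have one: "\<not> Q (s i) b c d"
    if i: "i \<in> I" "\<not> eqv b (s i)" "\<not> eqv c (s i)" "\<not> eqv d (s i)" "\<not> eqv c d" for i b c d
  proof
    assume q: "Q (s i) b c d"
    obtain j where j: "j \<in> I" "j \<noteq> i" "\<not> eqv b (s j)" "\<not> eqv c (s j)" "\<not> eqv d (s j)"
      using fresh_petal[of "{b,c,d}" "{i}"] by auto
    have "Q b (s i) c d" using q Q_swap by blast
    then have "Q (s j) (s i) c d \<or> Q b (s i) c (s j)"
      using Q_subst j s_mem by blast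
    then show False
    proof
      assume "Q (s j) (s i) c d"
      then show False using that j unfolding eqv_def by (metis Q_flip Q_swap)
    next
      assume "Q b (s i) c (s j)"
      then show False using two[of i j b c] i j by (metis Q_swap Q_swap')
    qed
  qed
  assume q: "Q a b c d"
  obtain i where i: "i \<in> I" "\<not> eqv a (s i)" "\<not> eqv b (s i)" "\<not> eqv c (s i)" "\<not> eqv d (s i)"
    using fresh_petal[of "{a,b,c,d}" "{}"] by auto
  have "Q (s i) b c d \<or> Q a b c (s i)" using Q_subst q i s_mem by blast
  then show False
    using one[of i b c d] one[of i c a b] i assms by (metis Q_flip Q_swap)
qed

text \<open>First \<open>d\<close> is replaced by a petal \<open>s i\<close> away from all the
  points, then D3 brings \<open>d\<close> back. The alternative db|ci fails: for \<open>c\<close>,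
  \<open>d\<close> in different sectors by \<open>distinct_sectors_not_Q\<close>, otherwise because
  \<open>c\<close>, \<open>d\<close> are themselves paired against \<open>b\<close> and
  \<open>s i\<close>.\<close>

lemma same_sector_Q:
  assumes ab: "eqv a b" and ac: "\<not> eqv a c" and ad: "\<not> eqv a d" and m: "c \<in> \<Omega>" "d \<in> \<Omega>"
  shows "Q a b c d"
proof -
  have *: "\<exists>i\<in>I. \<not> eqv c (s i) \<and> \<not> eqv d (s i) \<and> \<not> eqv b (s i) \<and> Q a b c (s i)"
    if ab: "eqv a b" and ac: "\<not> eqv a c" and m: "c \<in> \<Omega>" for a b c d
  proof -
    obtain i j where ij: "i \<in> I" "j \<in> I" "i \<noteq> j"
      and ni: "\<not> eqv b (s i)" "\<not> eqv c (s i)" "\<not> eqv d (s i)" and "\<not> eqv b (s j)"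
      using fresh_petals[of "{b,c,d}"] by (metis finite.simps insertCI)
    then have "Q a b (s i) (s j)" using eqv_Q ab by blast
    then have "Q c b (s i) (s j) \<or> Q a b (s i) c" using Q_subst m by blast
    moreover have "\<not> eqv c b" using ab ac eqv_trans eqv_sym by blast
    ultimately show ?thesis using ij ni Q_swap' unfolding eqv_def by blast
  qed
  obtain i where i: "i \<in> I" "\<not> eqv c (s i)" "\<not> eqv d (s i)" "\<not> eqv b (s i)" "Q a b c (s i)"
    using *[of a b c d] ab ac m by blast
  have "Q d b c (s i) \<or> Q a b c d" using Q_subst[OF i(5)] m by blast
  moreover have "\<not> Q d b c (s i)"
  proof (cases "eqv c d")
    case False
    then show ?thesis
      using distinct_sectors_not_Q[of d b c "s i"] i ab ac ad eqv_sym eqv_trans by blast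
  next
    case True
    have cb: "\<not> eqv d b" "\<not> eqv c b" using ab ac ad eqv_sym eqv_trans by blast+
    obtain k where k: "k \<in> I" "\<not> eqv d (s k)" "Q c d b (s k)"
      using *[of c d b d] True cb ab eqv_mem by blast
    show ?thesis
    proof (cases "k = i")
      case True
      then show ?thesis using k Q_excl Q_swap Q_flip by metis
    next
      case False
      have "Q c d (s k) (s i)" using eqv_Q k i True by blast
      then have "Q c d b (s i)" using k Q_trans' by blast
      then show ?thesis using Q_excl Q_swap Q_flip by metis
    qed
  qed
  ultimately show ?thesis by blast
qed

text \<open>This handles three points in one sector and a fourth outside. The alternative to the
  claim in D3 is xq|ry, which contradicts qr|xy.\<close>

lemma same_sector_trade:
  assumes "\<not> eqv x q" "\<not> eqv x r" "\<not> eqv y q" "\<not> eqv y r" "x \<in> \<Omega>" "y \<in> \<Omega>"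
    "eqv q r" "Q x q r t"
  shows "Q y q r t"
proof -
  have "Q y q r t \<or> Q x q r y" using Q_subst assms by blast
  moreover have "Q q r x y" using same_sector_Q assms eqv_sym by blast
  ultimately show ?thesis by (metis Q_excl Q_excl' Q_swap)
qed

section \<open>The sectors form the unique node splitting extending the petals\<close>

definition E where "E = {(x, y). eqv x y}"

lemma equiv_E: "equiv \<Omega> E"
proof (rule equivI)
  show "E \<subseteq> \<Omega> \<times> \<Omega>" using eqv_mem by (auto simp: E_def)
  show "refl_on \<Omega> E" using eqv_refl by (simp add: E_def refl_on_def)
  show "sym E" using eqv_sym by (simp add: E_def sym_def)
  show "trans E" using eqv_trans unfolding E_def trans_def by blast
qed

lemma sectors_eqv:
  assumes "S \<in> \<Omega> // E" "T \<in> \<Omega> // E" "a \<in> S" "b \<in> T"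
  shows "eqv a b \<longleftrightarrow> S = T"
  using quotient_eq_iff[OF equiv_E assms] by (auto simp: E_def)

text \<open>The infinitely many petals lie in pairwise different sectors, which settles the
  cardinality conditions. The two conditions on a splitting are \<open>same_sector_Q\<close> and
  \<open>distinct_sectors_not_Q\<close>.\<close>

lemma extension_sectors:
  "node_splitting \<Omega> D (\<Omega> // E) \<and> extends_parts (\<Omega> // E) (s ` I) {{s i} | i. i \<in> I}"
proof
  have sec: "E `` {s i} \<in> \<Omega> // E" "s i \<in> E `` {s i}" if "i \<in> I" for i
    using that s_mem eqv_refl quotientI[of "s i" \<Omega> E] by (auto simp: E_def)
  have "inj_on (\<lambda>i. E `` {s i}) I"
    by (rule inj_onI) (metis sec sectors_eqv petals_not_eqv)
  then have "infinite ((\<lambda>i. E `` {s i}) ` I)" using infinite_index finite_imageD by blast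
  then have inf: "infinite (\<Omega> // E)" using sec(1) by (meson finite_subset image_subsetI)
  have sub: "S \<subseteq> \<Omega>" if "S \<in> \<Omega> // E" for S
    using that equiv_E in_quotient_imp_subset by blast
  have "D a b c d" if "S \<in> \<Omega> // E" "a \<in> S" "b \<in> S" "c \<in> \<Omega> - S" "d \<in> \<Omega> - S" for S a b c d
  proof -
    have n: "\<not> eqv a x" if "x \<in> \<Omega> - S" for x
      using in_quotient_imp_closed[OF equiv_E \<open>S \<in> \<Omega> // E\<close> \<open>a \<in> S\<close>] that by (auto simp: E_def)
    have "eqv a b" using sectors_eqv that by blast
    then show ?thesis using same_sector_Q n that unfolding Q_def by blast
  qed
  moreover have "\<not> D a b c d" if "S1 \<in> \<Omega> // E" "S2 \<in> \<Omega> // E" "S3 \<in> \<Omega> // E" "S4 \<in> \<Omega> // E"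
    "distinct [S1, S2, S3, S4]" "a \<in> S1" "b \<in> S2" "c \<in> S3" "d \<in> S4" for S1 S2 S3 S4 a b c d
  proof -
    have "\<not> Q a b c d"
      by (rule distinct_sectors_not_Q) (use that sectors_eqv in auto)
    then show ?thesis using that sub unfolding Q_def by blast
  qed
  ultimately show "node_splitting \<Omega> D (\<Omega> // E)"
    unfolding node_splitting_def splitting_def
    using inf partition_on_quotient[OF equiv_E] by blast
  have meet: "S \<inter> s ` I = {s i}" if "S \<in> \<Omega> // E" "s i \<in> S" "i \<in> I" for S i
    using that sectors_eqv petals_not_eqv by blast
  show "extends_parts (\<Omega> // E) (s ` I) {{s i} | i. i \<in> I}"
    unfolding extends_parts_def
  proof (intro subset_antisym subsetI)
    fix X assume "X \<in> {S \<inter> s ` I | S. S \<in> \<Omega> // E} - {{}}"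
    then obtain S i where "X = S \<inter> s ` I" "S \<in> \<Omega> // E" "i \<in> I" "s i \<in> S" by auto
    then show "X \<in> {{s i} | i. i \<in> I}" using meet[of S i] by blast
  next
    fix X assume "X \<in> {{s i} | i. i \<in> I}"
    then obtain i where i: "i \<in> I" "X = {s i}" by blast
    then have "X = E `` {s i} \<inter> s ` I" using meet[OF sec(1)[OF i(1)] sec(2)[OF i(1)] i(1)] by simp
    then show "X \<in> {S \<inter> s ` I | S. S \<in> \<Omega> // E} - {{}}" using sec(1)[OF i(1)] i(2) by blast
  qed
qed

text \<open>A sector of \<open>P\<close> contains at most one petal, so two of any three petals
  avoid it and witness that its points are equivalent. Conversely, equivalent points in different
  sectors contradict one of the two conditions on a splitting.\<close>

lemma extension_unique:
  assumes "node_splitting \<Omega> D P" "extends_parts P (s ` I) {{s i} | i. i \<in> I}"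
  shows "P = \<Omega> // E"
proof -
  note spl = assms(1)[unfolded node_splitting_def splitting_def, THEN conjunct1]
  have part: "partition_on \<Omega> P"
    and one: "\<And>S a b c d. S \<in> P \<Longrightarrow> a \<in> S \<Longrightarrow> b \<in> S \<Longrightarrow> c \<in> \<Omega> - S \<Longrightarrow> d \<in> \<Omega> - S \<Longrightarrow> D a b c d"
    and two: "\<And>S1 S2 S3 S4 a b c d. S1 \<in> P \<Longrightarrow> S2 \<in> P \<Longrightarrow> S3 \<in> P \<Longrightarrow> S4 \<in> P \<Longrightarrow>
      distinct [S1, S2, S3, S4] \<Longrightarrow> a \<in> S1 \<Longrightarrow> b \<in> S2 \<Longrightarrow> c \<in> S3 \<Longrightarrow> d \<in> S4 \<Longrightarrow> \<not> D a b c d"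
    using spl by (simp, (elim conjE, simp)+)
  have sub: "S \<subseteq> \<Omega>" if "S \<in> P" for S using that part partition_onD1 by blast
  have disj: "S = T" if "S \<in> P" "T \<in> P" "x \<in> S" "x \<in> T" for S T x
    using partition_onD2[OF part] that by (auto simp: disjoint_def)
  have uni: "i = j" if "S \<in> P" "s i \<in> S" "s j \<in> S" "i \<in> I" "j \<in> I" for S i j
  proof -
    have "S \<inter> s ` I \<in> {{s i} | i. i \<in> I}"
      using assms(2)[unfolded extends_parts_def] that by blast
    then obtain k where "S \<inter> s ` I = {s k}" by blast
    moreover have "s i \<in> S \<inter> s ` I" "s j \<in> S \<inter> s ` I" using that by auto
    ultimately have "s i = s j" by simp
    then show ?thesis using s_inj that by blast
  qed
  have "eqv x y \<longleftrightarrow> (\<exists>S\<in>P. x \<in> S \<and> y \<in> S)" for x y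
  proof
    assume "\<exists>S\<in>P. x \<in> S \<and> y \<in> S"
    then obtain S where S: "S \<in> P" "x \<in> S" "y \<in> S" by blast
    obtain a b c where "a < b" "b < c" and m: "a \<in> I" "b \<in> I" "c \<in> I"
      using chain_above[of "{}"] by auto
    then have d: "a \<noteq> b" "b \<noteq> c" "a \<noteq> c" by auto
    then have "(s a \<notin> S \<and> s b \<notin> S) \<or> (s b \<notin> S \<and> s c \<notin> S) \<or> (s a \<notin> S \<and> s c \<notin> S)"
      using uni[OF S(1)] m by metis
    then obtain i j where "i \<in> I" "j \<in> I" "i \<noteq> j" "s i \<notin> S" "s j \<notin> S" using m d by blast
    then show "eqv x y" unfolding eqv_def Q_def using one S s_mem sub by blast
  next
    assume "eqv x y"
    then obtain i j where ij: "i \<in> I" "j \<in> I" "i \<noteq> j" and q: "Q x y (s i) (s j)"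
      unfolding eqv_def by blast
    have m: "x \<in> \<Omega>" "y \<in> \<Omega>" using q Q_mem by auto
    have part_of: "\<exists>S\<in>P. z \<in> S" if "z \<in> \<Omega>" for z using that partition_onD1[OF part] by blast
    obtain S T V W where p: "S \<in> P" "x \<in> S" "T \<in> P" "y \<in> T" "V \<in> P" "s i \<in> V" "W \<in> P" "s j \<in> W"
      using part_of[OF m(1)] part_of[OF m(2)] part_of[OF s_mem[OF ij(1)]] part_of[OF s_mem[OF ij(2)]]
      by blast
    have VW: "V \<noteq> W" using uni p ij by blast
    \<comment> \<open>A sector containing one point of each side and neither of the others pairs its
      two points across the bar.\<close>
    have no: "\<not> Q a b c d" if "A \<in> P" "a \<in> A" "c \<in> A" "b \<notin> A" "d \<notin> A" "b \<in> \<Omega>" "d \<in> \<Omega>" for A a b c d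
    proof -
      have "Q a c b d" using one[of A a c b d] that sub unfolding Q_def by blast
      then show ?thesis using Q_excl by blast
    qed
    have "S = T"
    proof (rule ccontr)
      assume ST: "S \<noteq> T"
      consider "S = V" | "S = W" | "T = V" | "T = W" | "distinct [S,T,V,W]"
        using ST VW by auto
      then show False
      proof cases
        case 1
        then have "y \<notin> S" "s j \<notin> S" using disj p ST VW by blast+
        then show False using no[of S x "s i" y "s j"] 1 p q m s_mem ij by blast
      next
        case 2
        then have "y \<notin> S" "s i \<notin> S" using disj p ST VW by blast+
        then show False using no[of S x "s j" y "s i"] 2 p Q_swap'[THEN iffD1, OF q] m s_mem ij by blast
      next
        case 3
        then have "x \<notin> T" "s j \<notin> T" using disj p ST VW by blast+
        then show False using no[of T y "s i" x "s j"] 3 p Q_swap[THEN iffD1, OF q] m s_mem ij by blast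
      next
        case 4
        then have "x \<notin> T" "s i \<notin> T" using disj p ST VW by blast+
        then show False using no[of T y "s j" x "s i"] 4 p Q_swap[THEN iffD1, OF Q_swap'[THEN iffD1, OF q]] m s_mem ij by blast
      next
        case 5
        then show False using two p q unfolding Q_def by blast
      qed
    qed
    then show "\<exists>S\<in>P. x \<in> S \<and> y \<in> S" using p by blast
  qed
  then have "E = {(x, y). \<exists>S\<in>P. x \<in> S \<and> y \<in> S}" unfolding E_def by auto
  then show ?thesis using partition_on_eq_quotient[OF part] by simp
qed

lemma petaled_hull:
  "\<Union>{S \<in> node_extension \<Omega> D (s ` I) {{s i} | i. i \<in> I}. \<exists>i\<in>I. s i \<in> S} = {x. \<exists>i\<in>I. eqv x (s i)}"
proof -
  have "node_extension \<Omega> D (s ` I) {{s i} | i. i \<in> I} = \<Omega> // E"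
    unfolding node_extension_def
    using extension_sectors extension_unique by (intro the_equality) auto
  moreover have "(\<exists>S\<in>\<Omega> // E. x \<in> S \<and> y \<in> S) \<longleftrightarrow> eqv x y" for x y
  proof
    show "\<exists>S\<in>\<Omega> // E. x \<in> S \<and> y \<in> S \<Longrightarrow> eqv x y" using sectors_eqv by blast
    assume e: "eqv x y"
    then have "E `` {x} \<in> \<Omega> // E" "x \<in> E `` {x}" "y \<in> E `` {x}"
      using eqv_mem[OF e] eqv_refl quotientI[of x \<Omega> E] by (auto simp: E_def)
    then show "\<exists>S\<in>\<Omega> // E. x \<in> S \<and> y \<in> S" by blast
  qed
  ultimately show ?thesis by (auto, metis, metis)
qed

section \<open>Weak indiscernibility over parameters, petaled case\<close>

text \<open>The relation pairing \<open>b\<close> with \<open>s i\<close> against two later petals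
  transfers to \<open>s a\<close>, so \<open>b\<close> would lie in the sectors of two
  petals.\<close>

lemma weakly_indiscernible_imp_not_petal:
  assumes "weakly_indiscernible_over D I s B" "b \<in> B" "i \<in> I"
  shows "\<not> eqv b (s i)"
proof
  assume e: "eqv b (s i)"
  obtain a c d where "i < a" "a < c" "c < d" and I: "a \<in> I" "c \<in> I" "d \<in> I"
    using chain_above[of "{i}"] assms(3) by auto
  then have less: "i < a" "i < c" "a < c" "a < d" "c < d" "\<not> a < i" "\<not> c < i" "\<not> c < a"
    "\<not> d < a" "\<not> d < c" by auto
  have "Q b (s i) (s a) (s c)" using petal_Q[OF e] assms(3) less I by auto
  then have "Q b (s a) (s c) (s d)"
    using weakly_indiscernible_param_3[OF assms(1,2,3) I(1,2) I] less s_mem I unfolding Q_def by simp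
  then have "eqv b (s a)" unfolding eqv_def using I less(5)[THEN less_imp_neq] by blast
  then show False using petal_unique[OF e] assms(3) I(1) less by blast
qed

lemma weakly_indiscernible_if_not_petal:
  assumes B: "B \<subseteq> \<Omega>" and np: "\<And>b i. b \<in> B \<Longrightarrow> i \<in> I \<Longrightarrow> \<not> eqv b (s i)"
  shows "weakly_indiscernible_over D I s B"
proof (rule weakly_indiscernibleI[OF B])
  show Bs: "B \<inter> s ` I = {}" using np eqv_refl s_mem by auto
  fix F x1 x2 x3 x4 y1 y2 y3 y4
  assume sim: "similar B F" and F: "{(x1, y1), (x2, y2), (x3, y3), (x4, y4)} \<subseteq> F"
    and dx: "distinct [x1, x2, x3, x4]" and dy: "distinct [y1, y2, y3, y4]"
    and my: "{y1, y2, y3, y4} \<subseteq> \<Omega>" and Q: "Q x1 x2 x3 x4"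
  have mx: "x1 \<in> \<Omega>" "x2 \<in> \<Omega>" "x3 \<in> \<Omega>" "x4 \<in> \<Omega>" using Q Q_mem by auto
  \<comment> \<open>A petal shares its sector neither with a parameter nor with another petal. A
    point with a companion in its sector is therefore a parameter and does not move.\<close>
  have fixed: "y = x"
    if "(x, y) \<in> F" "(x', y') \<in> F" "x \<noteq> x'" "eqv x x'" for x y x' y'
    using sim that(1)
  proof (cases rule: similar_cases)
    case (2 i j)
    note ij = 2
    from sim that(2) show ?thesis
    proof (cases rule: similar_cases)
      case 1
      then show ?thesis using np[of x' i] that ij eqv_sym by blast
    next
      case (2 i' j')
      then show ?thesis using that ij petals_not_eqv by blast
    qed
  qed
  have fixed': "y = x"
    if m: "(x, y) \<in> F" "(x', y') \<in> F" "y \<noteq> y'" "eqv y y'" for x y x' y'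
    using sim that(1)
  proof (cases rule: similar_cases)
    case (2 i j)
    note ij = 2
    from sim that(2) show ?thesis
    proof (cases rule: similar_cases)
      case 1
      then show ?thesis using np[of x' j] that ij eqv_sym by blast
    next
      case (2 i' j')
      then show ?thesis using that ij petals_not_eqv by blast
    qed
  qed
  have eqv_iff: "eqv x x' \<longleftrightarrow> eqv y y'"
    if "(x, y) \<in> F" "(x', y') \<in> F" "x \<noteq> x'" "y \<noteq> y'" for x y x' y'
    using fixed[of x y x' y'] fixed[of x' y' x y] fixed'[of x y x' y'] fixed'[of x' y' x y] that eqv_sym
    by metis
  have e: "eqv x1 x2 \<longleftrightarrow> eqv y1 y2" "eqv x1 x3 \<longleftrightarrow> eqv y1 y3" "eqv x1 x4 \<longleftrightarrow> eqv y1 y4"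
    "eqv x2 x3 \<longleftrightarrow> eqv y2 y3" "eqv x2 x4 \<longleftrightarrow> eqv y2 y4" "eqv x3 x4 \<longleftrightarrow> eqv y3 y4"
    using eqv_iff F dx dy by auto
  have trade: "Q b' q r t"
    if "(a, b') \<in> F" "(q, q') \<in> F" "(r, r') \<in> F" "\<not> eqv a q" "eqv q r" "a \<noteq> q" "a \<noteq> r"
      "b' \<noteq> q'" "b' \<noteq> r'" "q \<noteq> r" "b' \<in> \<Omega>" "Q a q r t" for a b' q q' r r' t
  proof -
    have "q' = q" "r' = r" using fixed[of q q' r r'] fixed[of r r' q q'] that eqv_sym by auto
    moreover have "\<not> eqv a r" using that eqv_trans eqv_sym by blast
    ultimately have "\<not> eqv b' q" "\<not> eqv b' r"
      using eqv_iff[of a b' q q'] eqv_iff[of a b' r r'] that by auto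
    then show ?thesis
      using same_sector_trade[of a q r b' t] \<open>\<not> eqv a r\<close> that Q_mem by blast
  qed
  have split: "\<not> Q a c b d" if "eqv a b" "\<not> eqv a c" "\<not> eqv a d" "{c, d} \<subseteq> \<Omega>" for a b c d
    using same_sector_Q[of a b c d] that Q_excl by blast
  have tr: "eqv a c" if "eqv a b" "eqv b c \<or> eqv c b" for a b c
    using that eqv_trans eqv_sym by blast
  \<comment> \<open>Distribution over the sectors: all four together, exactly three together, or the
    two points of one side apart from the other two. In what remains, a pair across the bar is apart
    from the others or all sectors differ, and the relation fails.\<close>
  consider (all) "eqv x1 x2" "eqv x1 x3" "eqv x1 x4"
    | (x1) "\<not> eqv x1 x2" "eqv x2 x3" "eqv x2 x4"
    | (x2) "\<not> eqv x2 x1" "eqv x1 x3" "eqv x1 x4"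
    | (x3) "\<not> eqv x3 x1" "eqv x1 x2" "eqv x1 x4"
    | (x4) "\<not> eqv x4 x1" "eqv x1 x2" "eqv x1 x3"
    | (s12) "eqv x1 x2" "\<not> eqv x1 x3" "\<not> eqv x1 x4"
    | (s34) "eqv x3 x4" "\<not> eqv x3 x1" "\<not> eqv x3 x2"
    | (bad) "\<not> Q x1 x2 x3 x4"
  proof -
    have "\<not> Q x1 x2 x3 x4" if "eqv x1 x3" "\<not> eqv x1 x2" "\<not> eqv x1 x4"
      using split[of x1 x3 x2 x4] that mx by simp
    moreover have "\<not> Q x1 x2 x3 x4" if "eqv x1 x4" "\<not> eqv x1 x2" "\<not> eqv x1 x3"
      using split[of x1 x4 x2 x3] that mx Q_swap' by simp
    moreover have "\<not> Q x1 x2 x3 x4" if "eqv x2 x3" "\<not> eqv x2 x1" "\<not> eqv x2 x4"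
      using split[of x2 x3 x1 x4] that mx Q_swap by simp
    moreover have "\<not> Q x1 x2 x3 x4" if "eqv x2 x4" "\<not> eqv x2 x1" "\<not> eqv x2 x3"
      using split[of x2 x4 x1 x3] that mx Q_swap[of x1 x2 x3 x4] Q_swap'[of x2 x1 x3 x4] by simp
    moreover note distinct_sectors_not_Q[of x1 x2 x3 x4]
    ultimately show thesis using that eqv_sym tr by metis
  qed
  then show "Q y1 y2 y3 y4"
  proof cases
    case all
    then have "y1 = x1" "y2 = x2" "y3 = x3" "y4 = x4"
      using fixed F dx eqv_sym by (metis distinct_length_2_or_more insert_subset)+
    then show ?thesis using Q by simp
  next
    case x1
    then have "y2 = x2" "y3 = x3" "y4 = x4"
      using fixed F dx eqv_sym by (metis distinct_length_2_or_more insert_subset)+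
    then show ?thesis
      using trade[of x1 y1 x2 y2 x3 y3 x4] Q F dx dy my x1 by auto
  next
    case x2
    then have y: "y1 = x1" "y3 = x3" "y4 = x4"
      using fixed F dx eqv_sym by (metis distinct_length_2_or_more insert_subset)+
    have "Q x2 x1 x3 x4" using Q Q_swap by blast
    then have "Q y2 x1 x3 x4"
      using trade[of x2 y2 x1 y1 x3 y3 x4] F dx dy my x2 by auto
    then show ?thesis using y Q_swap by blast
  next
    case x3
    then have y: "y1 = x1" "y2 = x2" "y4 = x4"
      using fixed F dx eqv_sym by (metis distinct_length_2_or_more insert_subset)+
    have "Q x3 x4 x1 x2" using Q Q_flip by blast
    moreover have "\<not> eqv x3 x4" "eqv x4 x1" using x3 eqv_sym tr by blast+
    ultimately have "Q y3 x4 x1 x2"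
      using trade[of x3 y3 x4 y4 x1 y1 x2] F dx dy my by auto
    then show ?thesis using y Q_flip by blast
  next
    case x4
    then have y: "y1 = x1" "y2 = x2" "y3 = x3"
      using fixed F dx eqv_sym by (metis distinct_length_2_or_more insert_subset)+
    have "Q x4 x3 x1 x2" using Q Q_flip Q_swap by blast
    moreover have "\<not> eqv x4 x3" "eqv x3 x1" using x4 eqv_sym tr by blast+
    ultimately have "Q y4 x3 x1 x2"
      using trade[of x4 y4 x3 y3 x1 y1 x2] F dx dy my by auto
    then show ?thesis using y Q_flip Q_swap by blast
  next
    case s12
    then show ?thesis using same_sector_Q[of y1 y2 y3 y4] e my by simp
  next
    case s34
    then have "Q y3 y4 y1 y2" using same_sector_Q[of y3 y4 y1 y2] e my eqv_sym by simp
    then show ?thesis using Q_flip by blast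
  next
    case bad
    then show ?thesis using Q by simp
  qed
qed

end

section \<open>Monotonic sequences: the hull and its complement\<close>

text \<open>The 24 arrangements of four points fall under three pairings, eight for each.\<close>

lemma (in D_set) no_D_relation_on_4:
  assumes m: "{a, b, c, d} \<subseteq> \<Omega>" and n: "\<not> Q a b c d" "\<not> Q a c b d" "\<not> Q a d b c"
  shows "no_D_relation_on D {a, b, c, d}"
  unfolding no_D_relation_on_def
proof (intro ballI impI notI)
  fix p q r t
  assume X: "p \<in> {a, b, c, d}" "q \<in> {a, b, c, d}" "r \<in> {a, b, c, d}" "t \<in> {a, b, c, d}"
    and dist: "distinct [p, q, r, t]" and "D p q r t"
  then have Q: "Q p q r t" using m unfolding Q_def by blast
  have n': "\<not> Q x y z w" if "\<not> Q y x z w \<or> \<not> Q x y w z \<or> \<not> Q z w x y" for x y z w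
    using that Q_swap Q_swap' Q_flip by blast
  have "\<not> Q b a c d" "\<not> Q a b d c" "\<not> Q b a d c" "\<not> Q c d a b" "\<not> Q d c a b" "\<not> Q c d b a" "\<not> Q d c b a"
    "\<not> Q c a b d" "\<not> Q a c d b" "\<not> Q c a d b" "\<not> Q b d a c" "\<not> Q d b a c" "\<not> Q b d c a" "\<not> Q d b c a"
    "\<not> Q d a b c" "\<not> Q a d c b" "\<not> Q d a c b" "\<not> Q b c a d" "\<not> Q c b a d" "\<not> Q b c d a" "\<not> Q c b d a"
    using n n' by meson+
  then show False using n X dist Q by (elim insertE emptyE) simp_all
qed

text \<open>Read \<open>a1, \<dots>, a4\<close> as consecutive leaves of a caterpillar; \<open>b\<close> lies beyond one of its ends.\<close>

lemma (in D_set) same_end: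
  assumes a: "Q a1 a2 a3 a4"
    and t: "Q a1 a2 a3 b \<or> Q a2 a3 a1 b" "Q a1 a2 a4 b \<or> Q a2 a4 a1 b"
      "Q a1 a3 a4 b \<or> Q a3 a4 a1 b" "Q a2 a3 a4 b \<or> Q a3 a4 a2 b"
    and h: "\<not> (Q a1 b a3 a4 \<and> Q a1 a2 b a4)"
  shows "(Q a1 a2 a3 b \<and> Q a2 a3 a4 b) \<or> (Q a2 a3 a1 b \<and> Q a3 a4 a2 b)"
proof -
  \<comment> \<open>Otherwise \<open>b\<close> would branch off between \<open>a2\<close> and
    \<open>a3\<close>: transitivity then yields both relations excluded by \<open>h\<close>, the
    ones defining \<open>H3\<close>.\<close>
  have 1: "Q a2 a3 a4 b" if "Q a1 a2 a3 b"
  proof (rule ccontr)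
    assume "\<not> Q a2 a3 a4 b"
    then have "Q b a2 a3 a4" using t Q_flip Q_swap by blast
    then have "Q a1 b a3 a4" using a Q_trans Q_swap by blast
    moreover have "Q a1 a2 b a4" using a that Q_trans' Q_swap' by blast
    ultimately show False using h by blast
  qed
  have 2: "\<not> (Q a2 a3 a1 b \<and> Q a2 a3 a4 b)"
  proof
    assume "Q a2 a3 a1 b \<and> Q a2 a3 a4 b"
    then have "Q a2 a3 a1 a4" using Q_trans' Q_swap' by blast
    then show False using a Q_excl' Q_flip by blast
  qed
  show ?thesis using 1 2 t by blast
qed

locale monotonic = D_seq +
  assumes mono: "i \<in> I \<Longrightarrow> j \<in> I \<Longrightarrow> k \<in> I \<Longrightarrow> l \<in> I \<Longrightarrow> i < j \<Longrightarrow> j < k \<Longrightarrow> k < l \<Longrightarrow>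
    Q (s i) (s j) (s k) (s l)"
begin

definition hull where "hull = s ` I \<union> H1 \<Omega> D I s \<union> H2 \<Omega> D I s \<union> H3 \<Omega> D I s"

text \<open>In each triple \<open>b\<close> goes with the least term, so it hangs to the left of
  every triple.\<close>

definition left_end :: "'a \<Rightarrow> bool" where
  "left_end b \<longleftrightarrow> b \<in> \<Omega> - s ` I \<and>
     (\<forall>i\<in>I. \<forall>j\<in>I. \<forall>k\<in>I. i < j \<longrightarrow> j < k \<longrightarrow> Q (s j) (s k) (s i) b)"

definition right_end :: "'a \<Rightarrow> bool" where
  "right_end b \<longleftrightarrow> b \<in> \<Omega> - s ` I \<and>
     (\<forall>i\<in>I. \<forall>j\<in>I. \<forall>k\<in>I. i < j \<longrightarrow> j < k \<longrightarrow> Q (s i) (s j) (s k) b)"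

lemma weakly_indiscernible_imp_not_hull:
  assumes w: "weakly_indiscernible_over D I s B" and b: "b \<in> B" "b \<in> \<Omega>"
  shows "b \<notin> hull"
proof
  have tr: "Q b (s i) (s j) (s k) \<longleftrightarrow> Q b (s i') (s j') (s k')"
    if "{i, j, k, i', j', k'} \<subseteq> I"
      "i < j \<longleftrightarrow> i' < j'" "j < i \<longleftrightarrow> j' < i'" "i < k \<longleftrightarrow> i' < k'"
      "k < i \<longleftrightarrow> k' < i'" "j < k \<longleftrightarrow> j' < k'" "k < j \<longleftrightarrow> k' < j'" for i j k i' j' k'
    using weakly_indiscernible_param_3[OF w b(1), of i j k i' j' k'] that b s_mem
    unfolding Q_def by auto
  obtain i1 i2 i3 i4 i5 where I: "i1 \<in> I" "i2 \<in> I" "i3 \<in> I" "i4 \<in> I" "i5 \<in> I"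
    and less: "i1 < i2" "i2 < i3" "i3 < i4" "i4 < i5"
    using chain_above[of "{}"] by auto
  then have less': "i1 < i3" "i1 < i4" "i1 < i5" "i2 < i4" "i2 < i5" "i3 < i5"
    "\<not> i2 < i1" "\<not> i3 < i1" "\<not> i3 < i2" "\<not> i4 < i1" "\<not> i4 < i2" "\<not> i4 < i3" by auto
  have m1234: "Q (s i1) (s i2) (s i3) (s i4)" using mono I less by blast
  have notin: "b \<notin> s ` I"
  proof
    assume "b \<in> s ` I"
    then obtain i where i: "i \<in> I" "b = s i" by blast
    obtain j where j: "j \<in> I" "i < j" using above[of "{i}"] i by auto
    then have "Q b b (s j) (s j)" unfolding Q_same using b i s_mem s_inj by auto
    then have "Q b b (s i) (s i)"
      using weakly_indiscernible_param_2[OF w b(1) i(1) j(1)] b s_mem i(1) unfolding Q_def by blast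
    then show False unfolding Q_same using i(2) by blast
  qed
  assume "b \<in> hull"
  then consider "b \<in> H1 \<Omega> D I s" | "b \<in> H2 \<Omega> D I s" | "b \<in> H3 \<Omega> D I s"
    using notin unfolding hull_def by blast
  then show False
  proof cases
    case 1
    then obtain i j k where ijk: "{i, j, k} \<subseteq> I" "i < j" "j < k" "D (s i) (s k) (s j) b"
      unfolding H1_def by blast
    then have "Q (s i) (s k) (s j) b" using b s_mem unfolding Q_def by blast
    then have "Q b (s j) (s k) (s i)" using Q_flip Q_swap by blast
    then have "Q b (s j') (s k') (s i')" if "{i', j', k'} \<subseteq> I" "i' < j'" "j' < k'" for i' j' k'
      using tr[of j k i j' k' i'] ijk that by (auto dest: less_trans)
    \<comment> \<open>Both \<open>s i2\<close> and \<open>s i3\<close> are paired with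
      \<open>b\<close> against \<open>s i1\<close> and \<open>s i4\<close>, hence with each
      other.\<close>
    then have "Q b (s i2) (s i4) (s i1)" "Q b (s i3) (s i4) (s i1)" using I less less' by auto
    then have "Q (s i2) (s i3) (s i4) (s i1)" using Q_trans Q_swap by blast
    then show False using m1234 by (metis Q_excl Q_swap Q_swap' Q_flip)
  next
    case 2
    then obtain i j k where ijk: "{i, j, k} \<subseteq> I" "i < j" "j < k"
      and no: "no_D_relation_on D {s i, s j, s k, b}"
      unfolding H2_def by blast
    have less'': "i < j" "j < k" "i < k" "\<not> j < i" "\<not> k < i" "\<not> k < j" using ijk by auto
    have "distinct [b, s i, s j, s k]" using notin ijk s_inj by auto
    then have "\<not> D b (s i) (s j) (s k)" "\<not> D b (s k) (s i) (s j)"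
      using no[unfolded no_D_relation_on_def, THEN bspec, THEN bspec, THEN bspec, THEN bspec,
          of b "s i" "s j" "s k"]
        no[unfolded no_D_relation_on_def, THEN bspec, THEN bspec, THEN bspec, THEN bspec,
          of b "s k" "s i" "s j"] by auto
    then have n: "\<not> Q b (s i) (s j) (s k)" "\<not> Q b (s k) (s i) (s j)" unfolding Q_def by auto
    \<comment> \<open>These are exactly the two outcomes of substituting \<open>b\<close> into
      \<open>m1234\<close>.\<close>
    have "\<not> Q b (s i2) (s i3) (s i4)" "\<not> Q b (s i3) (s i1) (s i2)"
      using n tr[of i j k i2 i3 i4] tr[of k i j i3 i1 i2] ijk(1) less'' I less less'
      by simp_all
    then show False using Q_subst[OF m1234 b(2)] by (metis Q_swap Q_flip)
  next
    case 3
    then obtain i j k l where ijkl: "{i, j, k, l} \<subseteq> I" "i < j" "j < k" "k < l"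
      "D (s i) b (s k) (s l)" "D (s i) (s j) b (s l)"
      unfolding H3_def by blast
    then have less'': "i < k" "i < l" "j < l" "\<not> j < i" "\<not> k < i" "\<not> l < i" "\<not> l < j" "\<not> l < k"
      by auto
    have "Q (s i) b (s k) (s l)" "Q (s i) (s j) b (s l)"
      using ijkl b s_mem unfolding Q_def by auto
    then have q: "Q b (s i) (s k) (s l)" "Q b (s l) (s i) (s j)" using Q_flip Q_swap by blast+
    \<comment> \<open>Both relations from \<open>H3\<close> are carried to the same triple, where
      \<open>b\<close> would go with its first and with its last term.\<close>
    have "Q b (s i1) (s i2) (s i3)" "Q b (s i3) (s i1) (s i2)"
      using q tr[of i k l i1 i2 i3] tr[of l i j i3 i1 i2] ijkl I less less' less''
      by simp_all
    then show False using Q_excl' by blast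
  qed
qed

text \<open>Avoiding \<open>H1\<close> and \<open>H2\<close> puts \<open>b\<close> to the left or
  right of each triple. Avoiding \<open>H3\<close> makes the side persist from a triple to the next
  one by \<open>same_end\<close>, so all triples agree.\<close>

lemma end_if_not_hull:
  assumes b: "b \<in> \<Omega>" "b \<notin> hull"
  shows "left_end b \<or> right_end b"
proof -
  let ?L = "\<lambda>i j k. Q (s j) (s k) (s i) b" and ?R = "\<lambda>i j k. Q (s i) (s j) (s k) b"
  have tri: "?L i j k \<or> ?R i j k" if "i \<in> I" "j \<in> I" "k \<in> I" "i < j" "j < k" for i j k
  proof (rule ccontr)
    assume n: "\<not> (?L i j k \<or> ?R i j k)"
    have "\<not> D (s i) (s k) (s j) b" using b that unfolding hull_def H1_def by blast
    then have "\<not> Q (s i) (s k) (s j) b" unfolding Q_def by blast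
    then have "no_D_relation_on D {s i, s j, s k, b}"
      using no_D_relation_on_4[of "s i" "s j" "s k" b] n s_mem b(1) that Q_flip Q_swap' by auto
    then show False using b that unfolding hull_def H2_def by blast
  qed
  have ends: "(?R i j k \<and> ?R j k l) \<or> (?L i j k \<and> ?L j k l)"
    if I: "i \<in> I" "j \<in> I" "k \<in> I" "l \<in> I" and less: "i < j" "j < k" "k < l" for i j k l
  proof -
    have less': "i < k" "i < l" "j < l" using less by auto
    have "\<not> (D (s i) b (s k) (s l) \<and> D (s i) (s j) b (s l))"
      using b I less unfolding hull_def H3_def by blast
    then have "\<not> (Q (s i) b (s k) (s l) \<and> Q (s i) (s j) b (s l))" unfolding Q_def by blast
    then show ?thesis
      using same_end[OF mono[OF I less], of b] tri[of i j k] tri[of i j l] tri[of i k l] tri[of j k l]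
        I less less' by blast
  qed
  have LR: "\<not> (?L i j k \<and> ?R i j k)" for i j k
    by (metis Q_excl Q_excl' Q_flip Q_swap)
  show ?thesis
  proof (rule ccontr)
    assume "\<not> ?thesis"
    then obtain i j k i' j' k' where I: "i \<in> I" "j \<in> I" "k \<in> I" "i' \<in> I" "j' \<in> I" "k' \<in> I"
      and less: "i < j" "j < k" "i' < j'" "j' < k'" and n: "\<not> ?L i j k" "\<not> ?R i' j' k'"
      using b unfolding left_end_def right_end_def hull_def by blast
    \<comment> \<open>Two triples with opposite sides are shifted upwards one term at a time until
      both become \<open>l\<close>, \<open>m\<close>, \<open>n\<close>.\<close>
    obtain l m n where lmn: "l \<in> I" "m \<in> I" "n \<in> I" "k < l" "k' < l" "l < m" "m < n"
      using chain_above[of "{k, k'}"] I by auto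
    have "?R i j k" "?L i' j' k'" using tri n I less by blast+
    then have "?R j k l" "?L j' k' l"
      using ends[of i j k l] ends[of i' j' k' l] LR I less lmn by blast+
    then have "?R k l m" "?L k' l m"
      using ends[of j k l m] ends[of j' k' l m] LR I less lmn by blast+
    then have "?R l m n" "?L l m n"
      using ends[of k l m n] ends[of k' l m n] LR I less lmn by blast+
    then show False using LR by blast
  qed
qed

section \<open>The order along the caterpillar\<close>

definition before where
  "before i p \<longleftrightarrow> left_end p \<or> (\<exists>h\<in>I. h \<le> i \<and> p = s h)"

definition after where
  "after j r \<longleftrightarrow> right_end r \<or> (\<exists>l\<in>I. j \<le> l \<and> r = s l)"

text \<open>Only the case of parameters beyond opposite ends is indirect: a term beyond
  \<open>s j\<close> stands in for \<open>r\<close>, and D3 then brings \<open>r\<close>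
  back.\<close>

lemma before_after_index:
  assumes ij: "i \<in> I" "j \<in> I" "i < j" and p: "before i p" and r: "after j r"
  shows "Q p (s i) (s j) r"
proof -
  have sij: "s i \<noteq> s j" using ij s_inj by auto
  have left: "Q p (s i) (s j) (s l)" if l: "l \<in> I" "j \<le> l" for l
  proof -
    consider "left_end p" "l = j" | "left_end p" "j < l" | h where "h \<in> I" "h = i" "p = s h"
      | h where "h \<in> I" "h < i" "j < l" "p = s h" | h where "h \<in> I" "h < i" "j = l" "p = s h"
      using p l unfolding before_def by force
    then show ?thesis
    proof cases
      case 1
      then show ?thesis unfolding 1(2) Q_same' left_end_def using ij s_mem sij by auto
    next
      case 2
      then have "Q (s j) (s l) (s i) p" using ij l unfolding left_end_def by blast
      then show ?thesis using Q_flip Q_swap by blast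
    next
      case 3
      then show ?thesis using ij l s_mem s_inj by (auto simp: Q_same)
    next
      case 4
      then show ?thesis using mono ij l by blast
    next
      case 5
      then show ?thesis using ij s_mem s_inj by (auto simp: Q_same')
    qed
  qed
  have right: "Q (s h) (s i) (s j) r" if h: "h \<in> I" "h \<le> i" and "right_end r" for h
  proof (cases "h = i")
    case True
    then show ?thesis using that ij s_mem sij unfolding right_end_def by (auto simp: Q_same)
  next
    case False
    then show ?thesis using that ij unfolding right_end_def by simp
  qed
  show ?thesis
  proof (cases "left_end p \<and> right_end r")
    case False
    then show ?thesis using left right p r unfolding before_def after_def by blast
  next
    case True
    obtain k where k: "k \<in> I" "j < k" using above[of "{j}"] ij by auto
    have "Q p (s i) (s j) (s k)" using left k by simp
    then have "Q r (s i) (s j) (s k) \<or> Q p (s i) (s j) r"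
      using Q_subst True unfolding right_end_def by blast
    moreover have "Q (s i) (s j) (s k) r" using True ij k unfolding right_end_def by blast
    ultimately show ?thesis by (metis Q_excl Q_swap Q_flip)
  qed
qed

lemma before_after:
  assumes ij: "i \<in> I" "j \<in> I" "i < j" and p: "before i p" "before i q" and r: "after j r" "after j t"
  shows "Q p q r t"
proof -
  have "Q p q (s j) x" if "after j x" for x
    using before_after_index[OF ij p(1) that] before_after_index[OF ij p(2) that] Q_trans Q_swap by blast
  then show ?thesis using r Q_trans' Q_swap' by blast
qed

text \<open>A partial order: points beyond the same end stay incomparable, since the sequence does
  not determine their relative position.\<close>

definition prec :: "'a \<Rightarrow> 'a \<Rightarrow> bool" where
  "prec p q \<longleftrightarrow> left_end p \<and> \<not> left_end q \<or> \<not> right_end p \<and> right_end q \<or>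
     (\<exists>i\<in>I. \<exists>j\<in>I. i < j \<and> p = s i \<and> q = s j)"

definition placed where "placed p \<longleftrightarrow> left_end p \<or> right_end p \<or> p \<in> s ` I"

lemma end_not_seq: "left_end p \<or> right_end p \<Longrightarrow> p \<notin> s ` I"
  unfolding left_end_def right_end_def by blast

lemma end_disjoint: "left_end p \<Longrightarrow> \<not> right_end p"
proof
  assume e: "left_end p" "right_end p"
  obtain i j k where "i \<in> I" "j \<in> I" "k \<in> I" "i < j" "j < k" using chain_above[of "{}"] by auto
  then have "Q (s j) (s k) (s i) p" "Q (s i) (s j) (s k) p"
    using e unfolding left_end_def right_end_def by blast+
  then show False by (metis Q_excl Q_excl' Q_flip Q_swap)
qed

lemma prec_seq: "i \<in> I \<Longrightarrow> j \<in> I \<Longrightarrow> prec (s i) (s j) \<longleftrightarrow> i < j"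
  unfolding prec_def using end_not_seq s_inj by blast

text \<open>Two indices \<open>i < j\<close> separate the pairs: the larger index occurring among
  \<open>p\<close>, \<open>q\<close> and the smaller among \<open>r\<close>, \<open>t\<close>. If a
  pair has no index, both its points lie beyond one end and unboundedness supplies one.\<close>

lemma prec_Q:
  assumes "placed p" "placed q" "placed r" "placed t" "prec p r" "prec p t" "prec q r" "prec q t"
  shows "Q p q r t"
proof -
  have p: "\<not> right_end p" "\<not> right_end q" "\<not> left_end r" "\<not> left_end t"
    using assms end_disjoint end_not_seq unfolding prec_def by blast+
  have P: "(left_end p \<and> left_end q) \<or> (\<exists>i\<in>I. (p = s i \<or> q = s i) \<and> before i p \<and> before i q)"
  proof -
    have *: "left_end p \<or> (\<exists>i\<in>I. p = s i)" "left_end q \<or> (\<exists>i\<in>I. q = s i)"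
      using assms(1,2) p unfolding placed_def by auto
    moreover have "\<exists>i\<in>I. (p = s i \<or> q = s i) \<and> before i p \<and> before i q"
      if "i \<in> I" "j \<in> I" "p = s i" "q = s j" for i j
      using that unfolding before_def by (cases "i \<le> j") (metis linear order_refl)+
    ultimately show ?thesis unfolding before_def by blast
  qed
  have R: "(right_end r \<and> right_end t) \<or> (\<exists>i\<in>I. (r = s i \<or> t = s i) \<and> after i r \<and> after i t)"
  proof -
    have *: "right_end r \<or> (\<exists>i\<in>I. r = s i)" "right_end t \<or> (\<exists>i\<in>I. t = s i)"
      using assms(3,4) p unfolding placed_def by auto
    moreover have "\<exists>i\<in>I. (r = s i \<or> t = s i) \<and> after i r \<and> after i t"
      if "i \<in> I" "j \<in> I" "r = s i" "t = s j" for i j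
      using that unfolding after_def by (cases "i \<le> j") (metis linear order_refl)+
    ultimately show ?thesis unfolding after_def by blast
  qed
  have "\<exists>i\<in>I. \<exists>j\<in>I. i < j \<and> before i p \<and> before i q \<and> after j r \<and> after j t"
  proof (cases "left_end p \<and> left_end q")
    case True
    then have u: "before i p \<and> before i q" for i unfolding before_def by blast
    have "\<exists>j\<in>I. after j r \<and> after j t" using R ne unfolding after_def by blast
    then show ?thesis using u unbounded_below[OF unb] by metis
  next
    case False
    then obtain i where i: "i \<in> I" "p = s i \<or> q = s i" "before i p" "before i q" using P by blast
    show ?thesis
    proof (cases "right_end r \<and> right_end t")
      case True
      obtain j where "j \<in> I" "i < j" using above[of "{i}"] i by auto
      then show ?thesis using i True unfolding after_def by blast
    next
      case False
      then obtain j where j: "j \<in> I" "r = s j \<or> t = s j" "after j r" "after j t" using R by blast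
      then have "i < j" using i assms(5-8) prec_seq by metis
      then show ?thesis using i j by blast
    qed
  qed
  then show ?thesis using before_after by blast
qed

lemma prec_total:
  assumes "placed p" "placed q" "p \<noteq> q"
  shows "prec p q \<or> prec q p \<or> left_end p \<and> left_end q \<or> right_end p \<and> right_end q"
proof (cases "p \<in> s ` I \<and> q \<in> s ` I")
  case True
  then show ?thesis using assms(3) prec_seq by (metis imageE linorder_neq_iff)
next
  case False
  then show ?thesis using assms end_disjoint unfolding prec_def placed_def by blast
qed

lemma prec_trans:
  assumes "prec p q" "prec q r"
  shows "prec p r"
proof (cases "left_end p \<or> right_end r")
  case True
  then show ?thesis using assms end_disjoint end_not_seq unfolding prec_def by blast
next
  case False
  then obtain i j where "i \<in> I" "j \<in> I" "i < j" "p = s i" "q = s j"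
    using assms end_disjoint end_not_seq unfolding prec_def by blast
  moreover then obtain j' k where "j' \<in> I" "k \<in> I" "j' < k" "q = s j'" "r = s k"
    using assms False end_disjoint end_not_seq unfolding prec_def by blast
  ultimately have "i \<in> I" "k \<in> I" "i < k" "p = s i" "r = s k" using s_inj by auto
  then show ?thesis unfolding prec_def by blast
qed

lemma prec_left: "left_end p \<Longrightarrow> prec p q \<longleftrightarrow> \<not> left_end q" "left_end p \<Longrightarrow> \<not> prec q p"
  using end_disjoint end_not_seq unfolding prec_def by blast+

lemma prec_right: "right_end p \<Longrightarrow> prec q p \<longleftrightarrow> \<not> right_end q" "right_end p \<Longrightarrow> \<not> prec p q"
  using end_disjoint end_not_seq unfolding prec_def by blast+

abbreviation split :: "'a \<Rightarrow> 'a \<Rightarrow> 'a \<Rightarrow> 'a \<Rightarrow> bool" where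
  "split p q r t \<equiv> prec p r \<and> prec p t \<and> prec q r \<and> prec q t"

text \<open>List the four points along the order. The cut in the middle fails only if the two middle
  points lie beyond the same end, and then a third point lies there as well.\<close>

lemma split_or_three:
  assumes "placed a" "placed b" "placed c" "placed d" "distinct [a, b, c, d]"
  shows "split a b c d \<or> split c d a b \<or> split a c b d \<or> split b d a c \<or> split a d b c \<or> split b c a d \<or>
    (\<exists>E\<in>{left_end, right_end}. E a \<and> E b \<and> E c \<or> E a \<and> E b \<and> E d \<or> E a \<and> E c \<and> E d \<or> E b \<and> E c \<and> E d)"
proof -
  note tot = prec_total[of a b] prec_total[of a c] prec_total[of a d] prec_total[of b c]
    prec_total[of b d] prec_total[of c d]
  show ?thesis using tot assms prec_left prec_right prec_trans end_disjoint
    by simp (smt (verit))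
qed

text \<open>The alternative in D3 pairs the two terms of the sequence across the bar, whereas
  \<open>prec_Q\<close> pairs them against \<open>q\<close> and \<open>r\<close>.\<close>

lemma end_trade:
  assumes E: "E \<in> {left_end, right_end}" "E q" "E r" and ij: "i \<in> I" "j \<in> I" and Q: "Q (s i) q r t"
  shows "Q (s j) q r t"
proof (cases "i = j")
  case False
  have "Q (s j) q r t \<or> Q (s i) q r (s j)" using Q_subst Q s_mem ij by blast
  moreover have "placed q" "placed r" "placed (s i)" "placed (s j)"
    using E ij unfolding placed_def by auto
  then have "Q (s i) (s j) q r \<or> Q q r (s i) (s j)"
    using E ij prec_Q prec_left(1) prec_right(1) end_not_seq by (metis imageI insertE singletonD)
  then have "\<not> Q (s i) q r (s j)" by (metis Q_excl Q_excl' Q_flip Q_swap)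
  ultimately show ?thesis by blast
qed (use Q in simp)

lemma weakly_indiscernible_if_ends:
  assumes B: "B \<subseteq> \<Omega>" and ends: "\<And>b. b \<in> B \<Longrightarrow> left_end b \<or> right_end b"
  shows "weakly_indiscernible_over D I s B"
proof (rule weakly_indiscernibleI[OF B])
  show Bs: "B \<inter> s ` I = {}" using ends end_not_seq by blast
  fix F x1 x2 x3 x4 y1 y2 y3 y4
  assume sim: "similar B F" and F: "{(x1, y1), (x2, y2), (x3, y3), (x4, y4)} \<subseteq> F"
    and dx: "distinct [x1, x2, x3, x4]" and dy: "distinct [y1, y2, y3, y4]"
    and Q: "Q x1 x2 x3 x4"
  have placed: "placed x \<and> placed y" if "(x, y) \<in> F" for x y
    using sim that by (cases rule: similar_cases) (use ends in \<open>auto simp: placed_def\<close>)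
  have same: "y = x" if "E \<in> {left_end, right_end}" "E x" "(x, y) \<in> F" for x y E
    using sim that(3) by (cases rule: similar_cases) (use that end_not_seq in auto)
  have prec: "prec x x' \<longleftrightarrow> prec y y'" if m: "(x, y) \<in> F" "(x', y') \<in> F" for x y x' y'
    using sim m(1)
  proof (cases rule: similar_cases)
    case 1
    show ?thesis using sim m(2)
      by (cases rule: similar_cases) (use 1 ends prec_left prec_right end_not_seq in \<open>auto, blast+\<close>)
  next
    case (2 i j)
    note ij = 2
    show ?thesis using sim m(2)
    proof (cases rule: similar_cases)
      case 1
      then show ?thesis
        using ends[of x'] prec_left[of x'] prec_right[of x'] end_not_seq[of x] end_not_seq[of y] ij by auto
    next
      case (2 i' j')
      then show ?thesis using ij m similar_less[OF sim] prec_seq by metis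
    qed
  qed
  have trade: "Q a' q r t" if "E \<in> {left_end, right_end}" "E q" "E r" "(a, a') \<in> F" "Q a q r t" for E a a' q r t
    using sim that(4)
  proof (cases rule: similar_cases)
    case 1
    then show ?thesis using that(5) by simp
  next
    case (2 i j)
    then show ?thesis using end_trade[OF that(1-3)] that(5) by blast
  qed
  have split: "split x1 x2 x3 x4 \<longleftrightarrow> split y1 y2 y3 y4" "split x3 x4 x1 x2 \<longleftrightarrow> split y3 y4 y1 y2"
    using prec F by auto
  have p: "placed x1" "placed x2" "placed x3" "placed x4" "placed y1" "placed y2" "placed y3" "placed y4"
    using placed F by blast+
  \<comment> \<open>By \<open>prec_Q\<close> a cut separating the points differently yields a
    competing pairing of the same four points.\<close>
  have bad: "\<not> Q x1 x2 x3 x4"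
    if "split x1 x3 x2 x4 \<or> split x2 x4 x1 x3 \<or> split x1 x4 x2 x3 \<or> split x2 x3 x1 x4"
  proof -
    have "Q x1 x3 x2 x4 \<or> Q x2 x4 x1 x3 \<or> Q x1 x4 x2 x3 \<or> Q x2 x3 x1 x4"
      using that prec_Q p by blast
    then show ?thesis by (metis Q_excl Q_excl' Q_flip)
  qed
  consider (s12) "split x1 x2 x3 x4" | (s34) "split x3 x4 x1 x2"
    | (three) E where "E \<in> {left_end, right_end}"
      "E x1 \<and> E x2 \<and> E x3 \<or> E x1 \<and> E x2 \<and> E x4 \<or> E x1 \<and> E x3 \<and> E x4 \<or> E x2 \<and> E x3 \<and> E x4"
  proof -
    have "\<not> (split x1 x3 x2 x4 \<or> split x2 x4 x1 x3 \<or> split x1 x4 x2 x3 \<or> split x2 x3 x1 x4)"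
      using bad Q by argo
    with split_or_three[OF p(1-4) dx]
    have "split x1 x2 x3 x4 \<or> split x3 x4 x1 x2 \<or> (\<exists>E\<in>{left_end, right_end}.
      E x1 \<and> E x2 \<and> E x3 \<or> E x1 \<and> E x2 \<and> E x4 \<or> E x1 \<and> E x3 \<and> E x4 \<or> E x2 \<and> E x3 \<and> E x4)"
      by argo
    then show thesis
    proof (elim disjE[of _ "_ \<or> (\<exists>E\<in>_. _ E)"] disjE[of _ "\<exists>E\<in>_. _ E"] bexE)
      fix E assume "E \<in> {left_end, right_end}"
        "E x1 \<and> E x2 \<and> E x3 \<or> E x1 \<and> E x2 \<and> E x4 \<or> E x1 \<and> E x3 \<and> E x4 \<or> E x2 \<and> E x3 \<and> E x4"
      then show thesis by (fact that(3))
    qed (fact that(1,2))+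
  qed
  then show "Q y1 y2 y3 y4"
  proof cases
    case s12
    then show ?thesis using split prec_Q p by blast
  next
    case s34
    then have "Q y3 y4 y1 y2" using split prec_Q p by blast
    then show ?thesis using Q_flip by blast
  next
    case three
    have e: "E x1 \<Longrightarrow> y1 = x1" "E x2 \<Longrightarrow> y2 = x2" "E x3 \<Longrightarrow> y3 = x3" "E x4 \<Longrightarrow> y4 = x4"
      using same[OF three(1)] F by auto
    have FF: "(x1, y1) \<in> F" "(x2, y2) \<in> F" "(x3, y3) \<in> F" "(x4, y4) \<in> F" using F by auto
    have q: "Q x2 x1 x3 x4" "Q x3 x4 x1 x2" "Q x4 x3 x1 x2" using Q Q_flip Q_swap by blast+
    from three(2) show ?thesis
    proof (elim disjE conjE)
      assume "E x1" "E x2" "E x3"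
      then have "Q y4 x3 x1 x2" using trade[OF three(1) _ _ FF(4) q(3)] by blast
      then show ?thesis using e \<open>E x1\<close> \<open>E x2\<close> \<open>E x3\<close> Q_flip Q_swap by metis
    next
      assume "E x1" "E x2" "E x4"
      then have "Q y3 x4 x1 x2" using trade[OF three(1) _ _ FF(3) q(2)] by blast
      then show ?thesis using e \<open>E x1\<close> \<open>E x2\<close> \<open>E x4\<close> Q_flip by metis
    next
      assume "E x1" "E x3" "E x4"
      then have "Q y2 x1 x3 x4" using trade[OF three(1) _ _ FF(2) q(1)] by blast
      then show ?thesis using e \<open>E x1\<close> \<open>E x3\<close> \<open>E x4\<close> Q_swap by metis
    next
      assume "E x2" "E x3" "E x4"
      then have "Q y1 x2 x3 x4" using trade[OF three(1) _ _ FF(1) Q] by blast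
      then show ?thesis using e \<open>E x2\<close> \<open>E x3\<close> \<open>E x4\<close> by metis
    qed
  qed
qed

end

section \<open>Constant sequences and the assembly of the cases\<close>

text \<open>A single repetition transfers through the formula \<open>Eq 0 1\<close> to all
  increasing pairs and makes the sequence constant.\<close>

lemma indiscernible_inj:
  assumes ind: "indiscernible \<Omega> D L U I s" and nc: "\<not> constant_seq I s"
    and I: "i \<in> I" "j \<in> I" and eq: "s i = s j"
  shows "i = j"
proof (rule ccontr)
  assume "i \<noteq> j"
  then obtain a b where ab: "a \<in> I" "b \<in> I" "a < b" "s a = s b"
    using I eq by (metis linorder_neq_iff)
  have "s k = s l" if "k \<in> I" "l \<in> I" "k < l" for k l
    using indiscernibleD[OF ind, of "Eq 0 1" "[a, b]" "[k, l]"] ab that by simp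
  then have "constant_seq I s" unfolding constant_seq_def by (metis linorder_neq_iff)
  then show False using nc by blast
qed

theorem mainTheorem16:
  fixes \<Omega> :: "'a set"
    and D :: "'a \<Rightarrow> 'a \<Rightarrow> 'a \<Rightarrow> 'a \<Rightarrow> bool"
    and L :: "'p set"
    and U :: "'p \<Rightarrow> 'a \<Rightarrow> bool"
    and I :: "'i::linorder set"
    and s :: "'i \<Rightarrow> 'a"
    and B :: "'a set"
  assumes "D_set \<Omega> D"
    and "unbounded_order I"
    and "s \<in> I \<rightarrow> \<Omega>"
    and "indiscernible \<Omega> D L U I s"
    and "B \<subseteq> \<Omega>"
  shows "weakly_indiscernible_over D I s B \<longleftrightarrow> B \<inter> discernible_hull \<Omega> D I s = {}"
proof (cases "constant_seq I s")
  case True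
  have "tval (s \<circ> u) t = tval (s \<circ> v) t" if "u \<in> V \<rightarrow> I" "v \<in> V \<rightarrow> I" "tvars t \<subseteq> V" for u v t V
    using that True unfolding constant_seq_def by (cases t) auto
  then have "weakly_indiscernible_over D I s B"
    unfolding weakly_indiscernible_over_def Let_def by (metis Un_upper1 Un_upper2 le_supI1)
  then show ?thesis using True by (simp add: discernible_hull_def)
next
  case False
  interpret D_set \<Omega> D by fact
  interpret D_seq \<Omega> D I s
  proof
    \<comment> \<open>The empty sequence counts as constant and is covered by the previous
      case.\<close>
    show "I \<noteq> {}" using False by (auto simp: constant_seq_def)
  qed (use assms indiscernible_inj[OF assms(4) False] in auto)
  show ?thesis
  proof (cases "petaled_seq D I s")
    case True
    interpret petaled \<Omega> D I s
    proof
      fix i j k l assume I: "i \<in> I" "j \<in> I" "k \<in> I" "l \<in> I" and ne: "i \<noteq> j" "k \<noteq> l"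
      show "\<not> Q (s i) (s j) (s k) (s l)"
      proof
        assume Q: "Q (s i) (s j) (s k) (s l)"
        then have "distinct [i, j, k, l]" using Q_disjoint ne by auto
        then show False using True I Q unfolding petaled_seq_def Q_def by blast
      qed
    qed
    have "discernible_hull \<Omega> D I s = {x. \<exists>i\<in>I. eqv x (s i)}"
      using True False petaled_hull by (simp add: discernible_hull_def)
    then show ?thesis
      using weakly_indiscernible_imp_not_petal[of B] weakly_indiscernible_if_not_petal[OF assms(5)]
      by blast
  next
    case np: False
    then have m: "monotonic_seq D I s" using petaled_or_monotonic[OF assms(4)] by blast
    interpret monotonic \<Omega> D I s
    proof
      fix i j k l assume "i \<in> I" "j \<in> I" "k \<in> I" "l \<in> I" "i < j" "j < k" "k < l"
      then show "Q (s i) (s j) (s k) (s l)" using m s_mem unfolding monotonic_seq_def Q_def by blast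
    qed
    have "discernible_hull \<Omega> D I s = hull"
      using m np False by (simp add: discernible_hull_def hull_def)
    moreover have "weakly_indiscernible_over D I s B" if "B \<inter> hull = {}"
      using that assms(5) weakly_indiscernible_if_ends[OF assms(5)] end_if_not_hull by blast
    ultimately show ?thesis
      using weakly_indiscernible_imp_not_hull[of B] assms(5) by blast
  qed
qed

end
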